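(* Let $\mathcal M=\langle\mathcal S,\mathcal A,P,c,\gamma\rangle$ and $\hat{\mathcal M}=\langle\mathcal S,\mathcal A,\hat P,\hat c,\gamma\rangle$ be two MDPs with costs bounded below, let $w:\mathcal S\to[1,\infty)$ and $\kappa>0$ with $\gamma\kappa<1$. Assume: (a) both models are DP-solvable with respect to $w$; (b) $\mathcal G(V^\star)\cap\Pi_S(\kappa,w)\neq\emptyset$ and $\hat{\mathcal G}(\hat V^\star)\cap\Pi_S(\kappa,w)\cap\hat\Pi_S(\kappa,w)\neq\emptyset$; (c) for each $a\in\mathcal A$ the open-loop policy $\pi_a$ (which selects $a$ with probability one in every state) belongs to $\Pi_S(\kappa,w)\cap\hat\Pi_S(\kappa,w)$, and $\mathcal G(\hat V^\star)$ and $\hat{\mathcal G}(V^\star)$ are nonempty. Let $\hat\pi^\star\in\hat{\mathcal G}(\hat V^\star)\cap\Pi_S(\kappa,w)\cap\hat\Pi_S(\kappa,w)$. Then $$\|V^{\hat\pi^\star}-V^\star\|_w\le\frac{2}{1-\gamma\kappa}\,\mathcal D^{\max}\hat V^\star\qquad\text{and}\qquad\|V^{\hat\pi^\star}-V^\star\|_w\le\frac{2}{(1-\gamma\kappa)^2}\,\mathcal D^{\max}V^\star .$$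
   Context: MDPs. An MDP $\mathcal M=\langle\mathcal S,\mathcal A,P,c,\gamma\rangle$ consists of Borel spaces $\mathcal S$ (states) and $\mathcal A$ (actions), a stochastic kernel $P(\cdot\mid s,a)$ from $\mathcal S\times\mathcal A$ to $\mathcal S$, a measurable per-step cost $c:\mathcal S\times\mathcal A\to\mathbb R$ bounded from below, and a discount factor $\gamma\in(0,1)$. The second MDP $\hat{\mathcal M}$ has the same $\mathcal S,\mathcal A,\gamma$ but possibly different kernel $\hat P$ and cost $\hat c$; $c_{\min}\in\mathbb R$ is a constant with $c\ge c_{\min}$ and $\hat c\ge c_{\min}$. A policy is a stochastic kernel $\pi:\mathcal S\to\Delta(\mathcal A)$ (time-homogeneous, possibly randomized); $\Pi$ is the set of all policies. Put $c_\pi(s)=\int_{\mathcal A}c(s,a)\pi(da|s)$, $P_\pi(ds'|s)=\int_{\mathcal A}\pi(da|s)P(ds'|s,a)$. The value function of $\pi$ is $V^\pi(s)=\mathbb E^\pi\bigl[\sum_{t\ge1}\gamma^{t-1}c(S_t,A_t)\mid S_1=s\bigr]$. Function space and operators. $\mathcal V$ is the set of measurable functions $\mathcal S\to[\frac{c_{\min}}{1-\gamma},\infty)\cup\{+\infty\}$. For $w:\mathcal S\to[1,\infty)$, $\|v\|_w=\sup_{s}|v(s)|/w(s)$ (also used for differences of functions) and $\mathcal V_w=\{v\in\mathcal V:\|v\|_w<\infty\}$. Bellman operators: $[\mathcal B^\pi v](s)=c_\pi(s)+\gamma\int v(s')P_\pi(ds'|s)$ and $[\mathcal B^\star v](s)=\inf_{a\in\mathcal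 A}\{c(s,a)+\gamma\int v(s')P(ds'|s,a)\}$. $\mathcal G(v)=\{\pi\in\Pi:\mathcal B^\pi v=\mathcal B^\star v\}$. DP-solvability. $\mathcal M$ is DP-solvable with respect to $w$ if (i) $\mathcal B^\star v\in\mathcal V_w$ for all $v\in\mathcal V_w$; (ii) there is $V^\star\in\mathcal V_w$ with $V^\star(s)\le V^\pi(s)$ for all $s$ and all $\pi\in\Pi$, with equality at all states for at least one $\pi\in\Pi$; (iii) $V^\star=\mathcal B^\star V^\star$. This $V^\star$ is the optimal value function. Stability. For $\kappa>0$ with $\gamma\kappa<1$, a policy $\pi$ is $(\kappa,w)$ stable for $\mathcal M$ if $\|c_\pi\|_w<\infty$ and $\int w(s')P_\pi(ds'|s)\le\kappa w(s)$ for all $s$. $\Pi_S(\kappa,w)$ is the set of $(\kappa,w)$-stable policies for $\mathcal M$. Hats denote the corresponding objects for $\hat{\mathcal M}$: $\hat V^\pi,\hat V^\star,\hat{\mathcal B}^\pi,\hat{\mathcal B}^\star,\hat{\mathcal G}(v),\hat\Pi_S(\kappa,w)$. $V^{\hat\pi^\star}$ is the value function of $\hat\pi^\star$ in $\mathcal M$. Bellman maximum mismatch functional: for $v\in\mathcal V_w$, $\mathcal D^{\max}v=\sup_{a\in\mathcal A}\|\mathcal B^{\pi_a}v-\hat{\mathcal B}^{\pi_a}v\|_w\in[0,+\infty]$. *)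

theory Defs
  imports "HOL-Probability.Probability"
begin

section \<open>Markov decision processes on Borel spaces\<close>

record ('s, 'a) mdp =
  states :: "'s set"
  actions :: "'a set"
  trans_kernel :: "'s \<times> 'a \<Rightarrow> 's measure"
  cost :: "'s \<times> 'a \<Rightarrow> real"
  discount :: real

definition stateM :: "('s::polish_space, 'a) mdp \<Rightarrow> 's measure" where
  "stateM M = restrict_space borel (states M)"

definition actionM :: "('s, 'a::polish_space) mdp \<Rightarrow> 'a measure" where
  "actionM M = restrict_space borel (actions M)"

text \<open>A Borel space is a Borel subset of a Polish space. A stochastic kernel is a measurable
  map into the space of probability measures.\<close>

definition is_mdp :: "('s::polish_space, 'a::polish_space) mdp \<Rightarrow> bool" where
  "is_mdp M \<longleftrightarrow>
     states M \<in> sets borel \<and> actions M \<in> sets borel \<and>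
     trans_kernel M \<in> (stateM M \<Otimes>\<^sub>M actionM M) \<rightarrow>\<^sub>M prob_algebra (stateM M) \<and>
     cost M \<in> borel_measurable (stateM M \<Otimes>\<^sub>M actionM M) \<and>
     (\<exists>b. \<forall>s\<in>states M. \<forall>a\<in>actions M. b \<le> cost M (s, a)) \<and>
     0 < discount M \<and> discount M < 1"

definition policies :: "('s::polish_space, 'a::polish_space) mdp \<Rightarrow> ('s \<Rightarrow> 'a measure) set" where
  "policies M = stateM M \<rightarrow>\<^sub>M prob_algebra (actionM M)"

definition open_loop :: "('s::polish_space, 'a::polish_space) mdp \<Rightarrow> 'a \<Rightarrow> 's \<Rightarrow> 'a measure" where
  "open_loop M a = (\<lambda>s. return (actionM M) a)"

text \<open>Integral of an extended real function, as the integral of the positive part minus that of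
  the negative part (\<^const>\<open>e2ennreal\<close> sends negative numbers to 0). Below it is only applied to
  functions bounded from below and probability measures, so the second term is finite.\<close>

definition eint :: "'b measure \<Rightarrow> ('b \<Rightarrow> ereal) \<Rightarrow> ereal" where
  "eint \<mu> f = enn2ereal (\<integral>\<^sup>+x. e2ennreal (f x) \<partial>\<mu>) - enn2ereal (\<integral>\<^sup>+x. e2ennreal (- f x) \<partial>\<mu>)"

definition pol_cost :: "('s::polish_space, 'a::polish_space) mdp \<Rightarrow> ('s \<Rightarrow> 'a measure) \<Rightarrow> 's \<Rightarrow> ereal" where
  "pol_cost M \<pi> s = eint (\<pi> s) (\<lambda>a. ereal (cost M (s, a)))"

definition pol_kernel :: "('s::polish_space, 'a::polish_space) mdp \<Rightarrow> ('s \<Rightarrow> 'a measure) \<Rightarrow> 's \<Rightarrow> 's measure" where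
  "pol_kernel M \<pi> s = \<pi> s \<bind> (\<lambda>a. trans_kernel M (s, a))"


section \<open>The controlled process and the value function\<close>

abbreviation saM :: "('s::polish_space, 'a::polish_space) mdp \<Rightarrow> ('s \<times> 'a) measure" where
  "saM M \<equiv> stateM M \<Otimes>\<^sub>M actionM M"

definition act :: "('s::polish_space, 'a::polish_space) mdp \<Rightarrow> ('s \<Rightarrow> 'a measure) \<Rightarrow> 's \<Rightarrow> ('s \<times> 'a) measure" where
  "act M \<pi> s = distr (\<pi> s) (saM M) (\<lambda>a. (s, a))"

text \<open>Conditional law of the \<open>n\<close>-th state-action pair given the history \<open>h 0, ..., h (n - 1)\<close>,
  for the process started in \<open>s\<close>. Time is counted from 0.\<close>

primrec step_kernel ::
  "('s::polish_space, 'a::polish_space) mdp \<Rightarrow> ('s \<Rightarrow> 'a measure) \<Rightarrow> 's \<Rightarrow> nat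
     \<Rightarrow> (nat \<Rightarrow> 's \<times> 'a) \<Rightarrow> ('s \<times> 'a) measure" where
  "step_kernel M \<pi> s 0 = (\<lambda>h. act M \<pi> s)"
| "step_kernel M \<pi> s (Suc n) = (\<lambda>h. trans_kernel M (h n) \<bind> act M \<pi>)"

text \<open>The law on \<open>(S \<times> A)\<^sup>\<nat>\<close> of the whole state-action sequence, given by the Ionescu-Tulcea
  theorem.\<close>

definition trajectory ::
  "('s::polish_space, 'a::polish_space) mdp \<Rightarrow> ('s \<Rightarrow> 'a measure) \<Rightarrow> 's \<Rightarrow> (nat \<Rightarrow> 's \<times> 'a) measure" where
  "trajectory M \<pi> s =
     projective_family.lim UNIV (Ionescu_Tulcea.CI (step_kernel M \<pi> s) (\<lambda>_. saM M)) (\<lambda>_. saM M)"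

text \<open>Since the cost is bounded from below and the discount factor is in (0, 1), the pathwise
  series of extended reals converges to a value in \<open>(-\<infinity>, \<infinity>]\<close>, bounded from below uniformly
  in the path.\<close>

definition value_fun :: "('s::polish_space, 'a::polish_space) mdp \<Rightarrow> ('s \<Rightarrow> 'a measure) \<Rightarrow> 's \<Rightarrow> ereal" where
  "value_fun M \<pi> s =
     eint (trajectory M \<pi> s) (\<lambda>\<omega>. \<Sum>t. ereal (discount M ^ t * cost M (\<omega> t)))"

lemma act_measurable:
  assumes "\<pi> \<in> policies M"
  shows "act M \<pi> \<in> stateM M \<rightarrow>\<^sub>M prob_algebra (saM M)"
  unfolding act_def[abs_def]
proof (rule measurable_distr_prob_space2)
  show "\<pi> \<in> stateM M \<rightarrow>\<^sub>M prob_algebra (actionM M)"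
    using assms by (simp add: policies_def)
  show "(\<lambda>(s, a). (s, a)) \<in> stateM M \<Otimes>\<^sub>M actionM M \<rightarrow>\<^sub>M saM M"
    by simp
qed

lemma Ionescu_Tulcea_step_kernel:
  assumes "is_mdp M" "\<pi> \<in> policies M" "s \<in> states M"
  shows "Ionescu_Tulcea (step_kernel M \<pi> s) (\<lambda>_. saM M)"
proof -
  have s: "s \<in> space (stateM M)"
    using assms(3) by (simp add: stateM_def space_restrict_space)
  note act = act_measurable[OF assms(2)]
  have *: "step_kernel M \<pi> s i \<in> (PiM {0..<i} (\<lambda>_. saM M)) \<rightarrow>\<^sub>M prob_algebra (saM M)" for i
  proof (cases i)
    case 0
    then show ?thesis
      using measurable_space[OF act s] by simp
  next
    case (Suc n)
    have "trans_kernel M \<in> saM M \<rightarrow>\<^sub>M prob_algebra (stateM M)"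
      using assms(1) by (simp add: is_mdp_def)
    then have "(\<lambda>h. trans_kernel M (h n)) \<in> (PiM {0..<i} (\<lambda>_. saM M)) \<rightarrow>\<^sub>M prob_algebra (stateM M)"
      by (rule measurable_compose[rotated]) (simp add: Suc measurable_component_singleton)
    from measurable_bind_prob_space[OF this act] show ?thesis
      by (simp add: Suc)
  qed
  show ?thesis
  proof (rule Ionescu_Tulcea.intro)
    show "step_kernel M \<pi> s i \<in> (PiM {0..<i} (\<lambda>_. saM M)) \<rightarrow>\<^sub>M subprob_algebra (saM M)" for i
      using * by (rule measurable_prob_algebraD)
    show "prob_space (step_kernel M \<pi> s i h)" if "h \<in> space (PiM {0..<i} (\<lambda>_. saM M))" for i h
      using measurable_space[OF * that] by (simp add: space_prob_algebra)
  qed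
qed


section \<open>Weighted norm, Bellman operators, solvability and stability\<close>

text \<open>The model enters only through its state space. The value may be infinite.\<close>

definition wnorm :: "('s::polish_space, 'a::polish_space) mdp \<Rightarrow> ('s \<Rightarrow> real) \<Rightarrow> ('s \<Rightarrow> ereal) \<Rightarrow> ennreal" where
  "wnorm M w v = (SUP s\<in>states M. e2ennreal \<bar>v s\<bar> / ennreal (w s))"

definition val_space :: "real \<Rightarrow> ('s::polish_space, 'a::polish_space) mdp \<Rightarrow> ('s \<Rightarrow> ereal) set" where
  "val_space cmin M =
     {v \<in> borel_measurable (stateM M). \<forall>s\<in>states M. ereal (cmin / (1 - discount M)) \<le> v s}"

definition wval_space ::
  "real \<Rightarrow> ('s \<Rightarrow> real) \<Rightarrow> ('s::polish_space, 'a::polish_space) mdp \<Rightarrow> ('s \<Rightarrow> ereal) set" where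
  "wval_space cmin w M = {v \<in> val_space cmin M. wnorm M w v < \<infinity>}"

definition bellman_pol ::
  "('s::polish_space, 'a::polish_space) mdp \<Rightarrow> ('s \<Rightarrow> 'a measure) \<Rightarrow> ('s \<Rightarrow> ereal) \<Rightarrow> 's \<Rightarrow> ereal" where
  "bellman_pol M \<pi> v s = pol_cost M \<pi> s + ereal (discount M) * eint (pol_kernel M \<pi> s) v"

definition bellman_opt ::
  "('s::polish_space, 'a::polish_space) mdp \<Rightarrow> ('s \<Rightarrow> ereal) \<Rightarrow> 's \<Rightarrow> ereal" where
  "bellman_opt M v s =
     (INF a\<in>actions M. ereal (cost M (s, a)) + ereal (discount M) * eint (trans_kernel M (s, a)) v)"

definition greedy :: "('s::polish_space, 'a::polish_space) mdp \<Rightarrow> ('s \<Rightarrow> ereal) \<Rightarrow> ('s \<Rightarrow> 'a measure) set" where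
  "greedy M v = {\<pi> \<in> policies M. \<forall>s\<in>states M. bellman_pol M \<pi> v s = bellman_opt M v s}"

text \<open>\<open>V\<close> is the optimal value function. It is determined by this up to its irrelevant values
  outside \<open>states M\<close>.\<close>

definition optimal_value ::
  "real \<Rightarrow> ('s \<Rightarrow> real) \<Rightarrow> ('s::polish_space, 'a::polish_space) mdp \<Rightarrow> ('s \<Rightarrow> ereal) \<Rightarrow> bool" where
  "optimal_value cmin w M V \<longleftrightarrow>
     V \<in> wval_space cmin w M \<and>
     (\<forall>\<pi>\<in>policies M. \<forall>s\<in>states M. V s \<le> value_fun M \<pi> s) \<and>
     (\<exists>\<pi>\<in>policies M. \<forall>s\<in>states M. V s = value_fun M \<pi> s) \<and>
     (\<forall>s\<in>states M. V s = bellman_opt M V s)"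

definition dp_solvable ::
  "real \<Rightarrow> ('s \<Rightarrow> real) \<Rightarrow> ('s::polish_space, 'a::polish_space) mdp \<Rightarrow> bool" where
  "dp_solvable cmin w M \<longleftrightarrow>
     (\<forall>v\<in>wval_space cmin w M. bellman_opt M v \<in> wval_space cmin w M) \<and>
     (\<exists>V. optimal_value cmin w M V)"

definition stable_policies ::
  "real \<Rightarrow> ('s \<Rightarrow> real) \<Rightarrow> ('s::polish_space, 'a::polish_space) mdp \<Rightarrow> ('s \<Rightarrow> 'a measure) set" where
  "stable_policies \<kappa> w M =
     {\<pi> \<in> policies M. wnorm M w (pol_cost M \<pi>) < \<infinity> \<and>
        (\<forall>s\<in>states M. (\<integral>\<^sup>+s'. ennreal (w s') \<partial>pol_kernel M \<pi> s) \<le> ennreal (\<kappa> * w s))}"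

definition mismatch_max ::
  "('s \<Rightarrow> real) \<Rightarrow> ('s::polish_space, 'a::polish_space) mdp \<Rightarrow> ('s, 'a) mdp \<Rightarrow> ('s \<Rightarrow> ereal) \<Rightarrow> ennreal" where
  "mismatch_max w M Mh v =
     (SUP a\<in>actions M. wnorm M w
        (\<lambda>s. bellman_pol M (open_loop M a) v s - bellman_pol Mh (open_loop Mh a) v s))"

end

theory Submission
  imports Defs
begin

text \<open>Both bounds compare fixed points of contractions. Stability of the open-loop policies says that
every single transition \<open>P(\<cdot> | s, a)\<close> increases the weight by a factor of at most \<open>\<kappa>\<close>. Hence, writing
\<open>Q v s a = c s a + \<gamma> \<integral> v dP(\<cdot> | s, a)\<close> for the state-action value and \<open>\<rho> = \<gamma> \<kappa> < 1\<close>, functions \<open>u\<close>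
and \<open>v\<close> with \<open>|u - v| \<le> C w\<close> satisfy \<open>|Q u s a - Q v s a| \<le> \<rho> C w s\<close> (\<open>q_value_contraction\<close>). The
mismatch at \<open>v\<close> is the least \<open>D\<close> with \<open>|Q v s a - Qh v s a| \<le> D w s\<close> for all \<open>s\<close> and \<open>a\<close>, where \<open>Qh\<close>
belongs to the second model. Both estimates are uniform in the action, and neither taking the
infimum over \<open>a\<close> nor averaging over \<open>a\<close> increases a uniform distance; so both pass to the optimality
operators and to the operators of a policy.

Let \<open>V\<close> and \<open>Vh\<close> be the optimal values and \<open>X\<close> the value in the first model of the policy \<open>\<pi>h\<close>.
Then \<open>V = inf\<^sub>a Q V\<close>, \<open>Vh = inf\<^sub>a Qh Vh\<close>, and \<open>Vh = \<integral> Qh Vh d\<pi>h\<close> because \<open>\<pi>h\<close>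
is greedy for \<open>Vh\<close> in the second model, while \<open>X = \<integral> Q X d\<pi>h\<close>. If \<open>D\<close> is the mismatch at \<open>Vh\<close>, then
\<open>|Q X - Qh Vh| \<le> |Q X - Q Vh| + |Q Vh - Qh Vh|\<close> gives \<open>\<parallel>X - Vh\<parallel> \<le> \<rho> \<parallel>X - Vh\<parallel> + D\<close>, so that
\<open>\<parallel>X - Vh\<parallel> \<le> D / (1 - \<rho>)\<close>; the same computation with infima gives \<open>\<parallel>V - Vh\<parallel> \<le> D / (1 - \<rho>)\<close>, and the
triangle inequality yields the first bound. If \<open>D\<close> is instead the mismatch at \<open>V\<close>, the estimate of
\<open>\<parallel>V - Vh\<parallel>\<close> survives, but \<open>X\<close> has to be compared with \<open>Vh\<close> through \<open>V\<close>:
\<open>Q X \<rightarrow> Q V \<rightarrow> Qh V \<rightarrow> Qh Vh\<close> costs \<open>\<rho> \<parallel>X - V\<parallel> + D + \<rho> \<parallel>V - Vh\<parallel>\<close>, and returning from \<open>Vh\<close> to \<open>V\<close>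
costs another \<open>\<parallel>V - Vh\<parallel>\<close>. So \<open>\<parallel>X - V\<parallel> \<le> \<rho> \<parallel>X - V\<parallel> + 2 D / (1 - \<rho>)\<close>, whence the square in the
second bound.

The analytic work is in \<open>X = \<integral> Q X d\<pi>h\<close> with \<open>X\<close> finite and bounded by a multiple of \<open>w\<close>
(\<open>value_fun_real\<close>), as \<open>X\<close> is an integral over the Ionescu-Tulcea measure on trajectories. Only the
laws of the single coordinates of that measure matter. They are first described by
appending one transition at the end; an induction turns this into prepending one transition
(\<open>nn_integral_trajectory_Suc_first\<close>), which is the Bellman equation term by term. After the lower
bound of the costs has been subtracted, everything is nonnegative, so sums and integrals can be
interchanged while infinite values are still possible.\<close>

section \<open>Integrals, infima and contractions\<close>

lemma eint_cong: "(\<And>x. x \<in> space \<mu> \<Longrightarrow> f x = g x) \<Longrightarrow> eint \<mu> f = eint \<mu> g"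
  unfolding eint_def
  by (auto intro!: arg_cong2[where f="(-)"] arg_cong[where f=enn2ereal] nn_integral_cong)

text \<open>The bridge from extended integrals to Bochner integrals: the value functions to be compared are
finite, and real integrals can be subtracted freely.\<close>

lemma eint_integrable:
  assumes "integrable \<mu> f"
  shows "eint \<mu> (\<lambda>x. ereal (f x)) = ereal (\<integral>x. f x \<partial>\<mu>)"
proof -
  have *: "(\<integral>\<^sup>+x. ennreal (f x) \<partial>\<mu>) < \<infinity>" "(\<integral>\<^sup>+x. ennreal (- f x) \<partial>\<mu>) < \<infinity>"
    using assms by (auto simp: real_integrable_def less_top)
  show ?thesis
    unfolding eint_def real_lebesgue_integral_def[OF assms]
    using * by (cases "\<integral>\<^sup>+x. ennreal (f x) \<partial>\<mu>"; cases "\<integral>\<^sup>+x. ennreal (- f x) \<partial>\<mu>") auto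
qed

text \<open>A function bounded below is a nonnegative function plus a constant, and its extended integral
splits accordingly even if it is \<open>\<infinity>\<close>. The value function is computed in this way, before it is
known to be finite.\<close>

lemma eint_add_const:
  assumes "prob_space \<mu>" and [measurable]: "g \<in> borel_measurable \<mu>"
    and f: "\<And>x. x \<in> space \<mu> \<Longrightarrow> f x = enn2ereal (g x) + ereal m"
  shows "eint \<mu> f = enn2ereal (\<integral>\<^sup>+x. g x \<partial>\<mu>) + ereal m"
proof -
  interpret prob_space \<mu> by fact
  let ?p = "\<lambda>x. e2ennreal (enn2ereal (g x) + ereal m)"
  let ?n = "\<lambda>x. e2ennreal (- (enn2ereal (g x) + ereal m))"
  \<comment> \<open>Since \<open>ennreal\<close> cuts off negative numbers, this is \<open>f = g + m\<close> with every negative part moved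
    to the other side; it is true for both signs of \<open>m\<close> and survives integration.\<close>
  have pw: "?p x + ennreal (- m) = g x + (?n x + ennreal m)" for x
  proof (cases "g x")
    case (real r)
    then have "?p x = ennreal (r + m)" "?n x = ennreal (- r - m)"
      by auto
    with real show ?thesis
      by (cases "0 \<le> m"; cases "0 \<le> r + m")
        (auto simp: ennreal_neg simp flip: ennreal_plus)
  qed simp
  have int: "(\<integral>\<^sup>+x. ?p x \<partial>\<mu>) + ennreal (- m) = (\<integral>\<^sup>+x. g x \<partial>\<mu>) + ((\<integral>\<^sup>+x. ?n x \<partial>\<mu>) + ennreal m)"
  proof -
    have "(\<integral>\<^sup>+x. ?p x \<partial>\<mu>) + ennreal (- m) = (\<integral>\<^sup>+x. ?p x + ennreal (- m) \<partial>\<mu>)"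
      by (subst nn_integral_add) (auto simp: emeasure_space_1)
    also have "\<dots> = (\<integral>\<^sup>+x. g x + (?n x + ennreal m) \<partial>\<mu>)"
      by (simp add: pw)
    also have "\<dots> = (\<integral>\<^sup>+x. g x \<partial>\<mu>) + ((\<integral>\<^sup>+x. ?n x \<partial>\<mu>) + ennreal m)"
      by (simp add: nn_integral_add emeasure_space_1)
    finally show ?thesis .
  qed
  have "(\<integral>\<^sup>+x. ?n x \<partial>\<mu>) \<le> (\<integral>\<^sup>+x. ennreal (- m) \<partial>\<mu>)"
  proof (intro nn_integral_mono)
    show "?n x \<le> ennreal (- m)" for x
      by (cases "g x") (auto intro: ennreal_leI simp: e2ennreal_neg)
  qed
  also have "\<dots> < \<infinity>"
    by (simp add: emeasure_space_1)
  finally have N: "(\<integral>\<^sup>+x. ?n x \<partial>\<mu>) < \<infinity>" .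
  have "eint \<mu> f = enn2ereal (\<integral>\<^sup>+x. ?p x \<partial>\<mu>) - enn2ereal (\<integral>\<^sup>+x. ?n x \<partial>\<mu>)"
    unfolding eint_def[symmetric] by (rule eint_cong) (rule f)
  also have "\<dots> = enn2ereal (\<integral>\<^sup>+x. g x \<partial>\<mu>) + ereal m"
    using int N
    by (cases "\<integral>\<^sup>+x. ?p x \<partial>\<mu>"; cases "\<integral>\<^sup>+x. ?n x \<partial>\<mu>"; cases "\<integral>\<^sup>+x. g x \<partial>\<mu>"; cases "0 \<le> m")
      (auto simp: ennreal_neg simp flip: ennreal_plus)
  finally show ?thesis .
qed

text \<open>Here \<open>g\<close> is arbitrary, so the right-hand integral is a supremum over simple functions below \<open>g\<close>
and cannot be rescaled by the usual rule. The constant is moved onto the measurable function \<open>f\<close>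
instead. This is what makes the drift condition usable for weights that are not measurable.\<close>

lemma nn_integral_le_cmult:
  assumes f: "f \<in> borel_measurable \<mu>" and C: "0 \<le> C"
    and le: "\<And>x. x \<in> space \<mu> \<Longrightarrow> f x \<le> ennreal C * g x"
  shows "(\<integral>\<^sup>+x. f x \<partial>\<mu>) \<le> ennreal C * (\<integral>\<^sup>+x. g x \<partial>\<mu>)"
proof (cases "C = 0")
  case True
  with le have "(\<integral>\<^sup>+x. f x \<partial>\<mu>) \<le> (\<integral>\<^sup>+x. 0 \<partial>\<mu>)"
    by (intro nn_integral_mono) simp
  then show ?thesis by simp
next
  case False
  with C have C: "0 < C" by simp
  have inv: "ennreal C * (ennreal (1 / C) * y) = y" "ennreal (1 / C) * (ennreal C * y) = y" for y
    using C by (simp_all add: mult.assoc[symmetric] flip: ennreal_mult)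
  have "(\<integral>\<^sup>+x. f x \<partial>\<mu>) = ennreal C * (\<integral>\<^sup>+x. ennreal (1 / C) * f x \<partial>\<mu>)"
    using f by (simp add: nn_integral_cmult inv)
  also have "\<dots> \<le> ennreal C * (\<integral>\<^sup>+x. g x \<partial>\<mu>)"
  proof (intro mult_left_mono nn_integral_mono)
    fix x assume "x \<in> space \<mu>"
    then have "ennreal (1 / C) * f x \<le> ennreal (1 / C) * (ennreal C * g x)"
      by (intro mult_left_mono le) auto
    then show "ennreal (1 / C) * f x \<le> g x" by (simp add: inv)
  qed simp
  finally show ?thesis .
qed

text \<open>Fubini's theorem for a kernel and an unbounded integrand. On nonnegative functions it is the
corresponding rule for \<open>nn_integral\<close>; the general case is the difference of positive and negative
part, both of which are dominated by \<open>|f|\<close>.\<close>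

lemma integral_bind_integrable:
  fixes f :: "'b \<Rightarrow> real"
  assumes N: "N \<in> \<mu> \<rightarrow>\<^sub>M subprob_algebra B" and f[measurable]: "f \<in> borel_measurable B"
    and fin: "(\<integral>\<^sup>+x. \<integral>\<^sup>+y. ennreal \<bar>f y\<bar> \<partial>N x \<partial>\<mu>) < \<infinity>"
    and int: "\<And>x. x \<in> space \<mu> \<Longrightarrow> integrable (N x) f"
  shows "integrable (\<mu> \<bind> N) f" and "integrable \<mu> (\<lambda>x. \<integral>y. f y \<partial>N x)"
    and "(\<integral>y. f y \<partial>(\<mu> \<bind> N)) = (\<integral>x. \<integral>y. f y \<partial>N x \<partial>\<mu>)"
proof -
  have meas: "g \<in> borel_measurable B \<Longrightarrow> (\<lambda>x. \<integral>y. g y \<partial>N x) \<in> borel_measurable \<mu>" for g :: "'b \<Rightarrow> real"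
    by (rule measurable_compose[OF N integral_measurable_subprob_algebra])
  have nonneg: "integrable (\<mu> \<bind> N) g \<and> integrable \<mu> (\<lambda>x. \<integral>y. g y \<partial>N x) \<and>
      (\<integral>y. g y \<partial>(\<mu> \<bind> N)) = (\<integral>x. \<integral>y. g y \<partial>N x \<partial>\<mu>)"
    if g[measurable]: "g \<in> borel_measurable B" and pos: "\<And>y. 0 \<le> g y" and le: "\<And>y. g y \<le> \<bar>f y\<bar>" for g
  proof (cases "space \<mu> = {}")
    case True
    then have "\<mu> \<bind> N = count_space {}" by (simp add: bind_empty)
    with True show ?thesis
      by (simp add: integrable_count_space lebesgue_integral_count_space_finite Bochner_Integration.integral_empty integrable_iff_bounded nn_integral_empty)
        (simp add: measurable_def)
  next
    case False
    have setsb: "sets (\<mu> \<bind> N) = sets B"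
      by (rule sets_bind_measurable[OF N False])
    have gb: "g \<in> borel_measurable (\<mu> \<bind> N)"
      unfolding measurable_cong_sets[OF setsb refl] by simp
    have gN: "integrable (N x) g" if "x \<in> space \<mu>" for x
      using subprob_measurableD(2)[OF N that]
      by (intro Bochner_Integration.integrable_bound[OF int[OF that]] AE_I2)
        (auto simp: pos le abs_of_nonneg cong: measurable_cong_sets)
    have eq: "(\<integral>\<^sup>+y. ennreal (g y) \<partial>(\<mu> \<bind> N)) = (\<integral>\<^sup>+x. ennreal (\<integral>y. g y \<partial>N x) \<partial>\<mu>)"
      using N by (subst nn_integral_bind[where B=B])
        (auto intro!: nn_integral_cong nn_integral_eq_integral gN simp: pos)
    have "(\<integral>\<^sup>+y. ennreal (g y) \<partial>(\<mu> \<bind> N)) = (\<integral>\<^sup>+x. \<integral>\<^sup>+y. ennreal (g y) \<partial>N x \<partial>\<mu>)"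
      using N by (intro nn_integral_bind[where B=B]) auto
    also have "\<dots> \<le> (\<integral>\<^sup>+x. \<integral>\<^sup>+y. ennreal \<bar>f y\<bar> \<partial>N x \<partial>\<mu>)"
      by (intro nn_integral_mono ennreal_leI le)
    finally have bnd: "(\<integral>\<^sup>+y. ennreal (g y) \<partial>(\<mu> \<bind> N)) < \<infinity>"
      using fin by (rule le_less_trans)
    have i1: "integrable (\<mu> \<bind> N) g"
      using bnd pos gb by (intro integrableI_nonneg) auto
    have i2: "integrable \<mu> (\<lambda>x. \<integral>y. g y \<partial>N x)"
      using bnd pos meas[OF g] unfolding eq by (intro integrableI_nonneg) auto
    show ?thesis
      using i1 i2 eq meas[OF g] gb pos by (simp add: integral_eq_nn_integral)
  qed
  let ?p = "\<lambda>y. max 0 (f y)" and ?n = "\<lambda>y. max 0 (- f y)"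
  have f_eq: "f = (\<lambda>y. ?p y - ?n y)" by auto
  have p: "integrable (\<mu> \<bind> N) ?p \<and> integrable \<mu> (\<lambda>x. \<integral>y. ?p y \<partial>N x) \<and>
      (\<integral>y. ?p y \<partial>(\<mu> \<bind> N)) = (\<integral>x. \<integral>y. ?p y \<partial>N x \<partial>\<mu>)"
    by (rule nonneg) auto
  have n: "integrable (\<mu> \<bind> N) ?n \<and> integrable \<mu> (\<lambda>x. \<integral>y. ?n y \<partial>N x) \<and>
      (\<integral>y. ?n y \<partial>(\<mu> \<bind> N)) = (\<integral>x. \<integral>y. ?n y \<partial>N x \<partial>\<mu>)"
    by (rule nonneg) auto
  have split: "(\<integral>y. f y \<partial>N x) = (\<integral>y. ?p y \<partial>N x) - (\<integral>y. ?n y \<partial>N x)" if "x \<in> space \<mu>" for x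
    using int[OF that] by (subst f_eq, intro Bochner_Integration.integral_diff) auto
  show "integrable (\<mu> \<bind> N) f"
    using p n by (subst f_eq) (intro Bochner_Integration.integrable_diff, auto)
  show "integrable \<mu> (\<lambda>x. \<integral>y. f y \<partial>N x)"
    using p n by (subst Bochner_Integration.integrable_cong[OF refl split]) auto
  have "(\<integral>y. f y \<partial>(\<mu> \<bind> N)) = (\<integral>y. ?p y \<partial>(\<mu> \<bind> N)) - (\<integral>y. ?n y \<partial>(\<mu> \<bind> N))"
    using p n by (subst f_eq, intro Bochner_Integration.integral_diff) auto
  also have "\<dots> = (\<integral>x. (\<integral>y. ?p y \<partial>N x) - (\<integral>y. ?n y \<partial>N x) \<partial>\<mu>)"
    using p n by simp
  also have "\<dots> = (\<integral>x. \<integral>y. f y \<partial>N x \<partial>\<mu>)"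
    by (intro Bochner_Integration.integral_cong) (simp_all add: split)
  finally show "(\<integral>y. f y \<partial>(\<mu> \<bind> N)) = (\<integral>x. \<integral>y. f y \<partial>N x \<partial>\<mu>)" .
qed

lemma (in prob_space) abs_integral_diff_le:
  fixes f g :: "'a \<Rightarrow> real"
  assumes "integrable M f" "integrable M g" and le: "\<And>x. x \<in> space M \<Longrightarrow> \<bar>f x - g x\<bar> \<le> e"
  shows "\<bar>(\<integral>x. f x \<partial>M) - (\<integral>x. g x \<partial>M)\<bar> \<le> e"
proof -
  have "\<bar>(\<integral>x. f x \<partial>M) - (\<integral>x. g x \<partial>M)\<bar> = \<bar>\<integral>x. f x - g x \<partial>M\<bar>"
    using assms by simp
  also have "\<dots> \<le> (\<integral>x. \<bar>f x - g x\<bar> \<partial>M)"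
    by (rule integral_abs_bound)
  also have "\<dots> \<le> (\<integral>x. e \<partial>M)"
    using assms by (intro integral_mono) auto
  finally show ?thesis by (simp add: prob_space)
qed

lemma abs_INF_diff_le:
  fixes f g :: "'b \<Rightarrow> real"
  assumes x: "ereal x = (INF a\<in>A. ereal (f a))" and y: "ereal y = (INF a\<in>A. ereal (g a))"
    and le: "\<And>a. a \<in> A \<Longrightarrow> \<bar>f a - g a\<bar> \<le> e"
  shows "\<bar>x - y\<bar> \<le> e"
proof -
  have *: "x' \<le> y' + e"
    if "ereal x' = (INF a\<in>A. ereal (f' a))" "ereal y' = (INF a\<in>A. ereal (g' a))"
      "\<And>a. a \<in> A \<Longrightarrow> f' a \<le> g' a + e" for x' y' and f' g' :: "'b \<Rightarrow> real"
  proof -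
    have "ereal (x' - e) \<le> ereal y'"
      unfolding that(2)
    proof (rule INF_greatest)
      fix a assume a: "a \<in> A"
      have "ereal x' \<le> ereal (f' a)" unfolding that(1) by (rule INF_lower[OF a])
      with that(3)[OF a] show "ereal (x' - e) \<le> ereal (g' a)" by simp
    qed
    then show ?thesis by simp
  qed
  have "f a \<le> g a + e" "g a \<le> f a + e" if "a \<in> A" for a
    using le[OF that] by linarith+
  then have "x \<le> y + e" "y \<le> x + e"
    by (auto intro: *[OF x y] *[OF y x])
  then show ?thesis by linarith
qed

text \<open>The abstract form of \<open>\<parallel>e\<parallel> \<le> \<rho> \<parallel>e\<parallel> + d\<close> implies \<open>\<parallel>e\<parallel> \<le> d / (1 - \<rho>)\<close>. The a priori bound \<open>C0\<close>
excludes the infinite norm; the affine map \<open>C \<mapsto> \<rho> C + d\<close> is then iterated on bounds towards its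
fixed point, so no norm has to be formed.\<close>

lemma contraction_bound:
  fixes e w :: "'b \<Rightarrow> real"
  assumes \<rho>: "0 \<le> \<rho>" "\<rho> < 1" and d: "0 \<le> d" and C0: "0 \<le> C0"
    and w: "\<And>s. s \<in> S \<Longrightarrow> 0 \<le> w s"
    and init: "\<And>s. s \<in> S \<Longrightarrow> e s \<le> C0 * w s"
    and step: "\<And>C s. 0 \<le> C \<Longrightarrow> (\<And>s. s \<in> S \<Longrightarrow> e s \<le> C * w s) \<Longrightarrow> s \<in> S \<Longrightarrow> e s \<le> (\<rho> * C + d) * w s"
    and s: "s \<in> S"
  shows "e s \<le> d / (1 - \<rho>) * w s"
proof -
  let ?C = "\<lambda>n. \<rho> ^ n * C0 + d / (1 - \<rho>)"
  have C_nonneg: "0 \<le> ?C n" for n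
    using \<rho> d C0 by simp
  \<comment> \<open>The bound starts at \<open>C0 + d / (1 - \<rho>)\<close> rather than \<open>C0\<close>, which makes the iteration explicit:
    the fixed point is carried along unchanged.\<close>
  have C_rec: "\<rho> * ?C n + d = ?C (Suc n)" for n
    using \<rho> by (simp add: field_simps)
  have iter: "s \<in> S \<Longrightarrow> e s \<le> ?C n * w s" for n s
  proof (induction n arbitrary: s)
    case 0
    have "C0 * w s \<le> (C0 + d / (1 - \<rho>)) * w s"
      using \<rho> d w[OF 0] by (intro mult_right_mono) auto
    with init[OF 0] show ?case by simp
  next
    case (Suc n)
    show ?case using step[OF C_nonneg Suc.IH Suc.prems] unfolding C_rec .
  qed
  have "(\<lambda>n. ?C n * w s) \<longlonglongrightarrow> (0 * C0 + d / (1 - \<rho>)) * w s"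
    using \<rho> by (intro tendsto_intros LIMSEQ_realpow_zero)
  then show ?thesis
    using iter[OF s] by (intro LIMSEQ_le_const[of "\<lambda>n. ?C n * w s"]) auto
qed

text \<open>For an infinite mismatch there is nothing to prove, as the constant is positive; so the
bounds may be shown for real numbers.\<close>

lemma ennreal_mult_le_if_real_bound:
  assumes K: "0 < K" and bound: "\<And>d. 0 \<le> d \<Longrightarrow> D \<le> ennreal d \<Longrightarrow> N \<le> ennreal (K * d)"
  shows "N \<le> ennreal K * D"
proof (cases D)
  case (real d)
  with bound[of d] K show ?thesis by (simp add: ennreal_mult)
next
  case top
  with K show ?thesis by (simp add: ennreal_mult_top)
qed

section \<open>One-dimensional marginals of an Ionescu-Tulcea process\<close>

context Ionescu_Tulcea
begin

text \<open>On the first \<open>n\<close> coordinates the limit agrees with the measure \<open>C 0 n\<close> obtained by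
composing \<open>n\<close> kernels. The starting history is empty, hence \<open>undefined\<close> everywhere.\<close>

lemma nn_integral_lim_restrict:
  assumes [measurable]: "f \<in> borel_measurable (PiM {0..<n} M)"
  shows "(\<integral>\<^sup>+\<omega>. f (restrict \<omega> {0..<n}) \<partial>PF.lim) = (\<integral>\<^sup>+x. f x \<partial>C 0 n (\<lambda>_. undefined))"
proof -
  have up: "up_to {0..<n} = n"
  proof (rule antisym)
    show "up_to {0..<n} \<le> n" by (subst up_to_iff_Ico) auto
    show "n \<le> up_to {0..<n}" using up_to[of "{0..<n}"] by (cases n) auto
  qed
  have [measurable]: "(\<lambda>\<omega>. restrict \<omega> {0..<n}) \<in> PF.lim \<rightarrow>\<^sub>M PiM {0..<n} M"
    unfolding measurable_cong_sets[OF PF.sets_lim refl] by (rule measurable_restrict_subset) simp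
  have u: "(\<lambda>_. undefined) \<in> space (PiM {0..<0} M)"
    by (simp add: space_PiM)
  have sets_C0: "sets (C 0 n (\<lambda>_. undefined)) = sets (PiM {0..<n} M)"
    using sets_C[OF u, of n] by simp
  have [measurable]: "(\<lambda>\<omega>. restrict \<omega> {0..<n}) \<in> C 0 n (\<lambda>_. undefined) \<rightarrow>\<^sub>M PiM {0..<n} M"
    unfolding measurable_cong_sets[OF sets_C0 refl] by (rule measurable_restrict_subset) simp
  have "(\<integral>\<^sup>+\<omega>. f (restrict \<omega> {0..<n}) \<partial>PF.lim)
      = (\<integral>\<^sup>+x. f x \<partial>distr PF.lim (PiM {0..<n} M) (\<lambda>\<omega>. restrict \<omega> {0..<n}))"
    by (subst nn_integral_distr) auto
  also have "\<dots> = (\<integral>\<^sup>+x. f x \<partial>CI {0..<n})"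
    by (subst distr_lim) auto
  also have "\<dots> = (\<integral>\<^sup>+x. f (restrict x {0..<n}) \<partial>C 0 n (\<lambda>_. undefined))"
    unfolding CI_def up by (subst nn_integral_distr) auto
  also have "\<dots> = (\<integral>\<^sup>+x. f x \<partial>C 0 n (\<lambda>_. undefined))"
    by (intro nn_integral_cong)
      (auto simp: sets_eq_imp_space_eq[OF sets_C0] space_PiM intro!: arg_cong[where f=f] PiE_restrict)
  finally show ?thesis .
qed

text \<open>The defining property of the process: given the past, coordinate \<open>n\<close> is distributed
according to the kernel \<open>P n\<close>.\<close>

lemma nn_integral_lim_coordinate:
  assumes [measurable]: "g \<in> borel_measurable (M n)"
  shows "(\<integral>\<^sup>+\<omega>. g (\<omega> n) \<partial>PF.lim) = (\<integral>\<^sup>+\<omega>. (\<integral>\<^sup>+y. g y \<partial>P n (restrict \<omega> {0..<n})) \<partial>PF.lim)"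
proof -
  have u: "(\<lambda>_. undefined) \<in> space (PiM {0..<0} M)"
    by (simp add: space_PiM)
  have sp: "space (C 0 n (\<lambda>_. undefined)) = space (PiM {0..<n} M)"
    using space_C[OF u, of n] by simp
  have setsC: "sets (C 0 n (\<lambda>_. undefined)) = sets (PiM {0..<n} M)"
    using sets_C[OF u, of n] by simp
  have [measurable]: "(\<lambda>x. g (x n)) \<in> borel_measurable (PiM {0..<Suc n} M)"
    by (rule measurable_compose[OF measurable_component_singleton]) auto
  have eP: "eP n \<in> measurable (C 0 n (\<lambda>_. undefined)) (subprob_algebra (PiM {0..<Suc n} M))"
    unfolding measurable_cong_sets[OF setsC refl] by (rule measurable_eP)
  have "(\<integral>\<^sup>+\<omega>. g (\<omega> n) \<partial>PF.lim) = (\<integral>\<^sup>+\<omega>. g (restrict \<omega> {0..<Suc n} n) \<partial>PF.lim)"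
    by simp
  also have "\<dots> = (\<integral>\<^sup>+x. g (x n) \<partial>C 0 (Suc n) (\<lambda>_. undefined))"
    by (rule nn_integral_lim_restrict) simp
  also have "\<dots> = (\<integral>\<^sup>+x. (\<integral>\<^sup>+y. g (y n) \<partial>eP n x) \<partial>C 0 n (\<lambda>_. undefined))"
    using eP by (simp add: nn_integral_bind[where B="PiM {0..<Suc n} M"])
  also have "\<dots> = (\<integral>\<^sup>+x. (\<integral>\<^sup>+y. g y \<partial>P n x) \<partial>C 0 n (\<lambda>_. undefined))"
    by (intro nn_integral_cong) (simp add: sp nn_integral_eP)
  also have "\<dots> = (\<integral>\<^sup>+\<omega>. (\<integral>\<^sup>+y. g y \<partial>P n (restrict \<omega> {0..<n})) \<partial>PF.lim)"
    by (rule nn_integral_lim_restrict[symmetric])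
      (rule measurable_compose[OF P nn_integral_measurable_subprob_algebra], simp)
  finally show ?thesis .
qed

lemma prob_space_lim: "prob_space PF.lim"
proof
  have "emeasure PF.lim (space PF.lim) = (\<integral>\<^sup>+\<omega>. 1 \<partial>PF.lim)"
    by simp
  also have "\<dots> = (\<integral>\<^sup>+x. 1 \<partial>C 0 0 (\<lambda>_. undefined))"
    by (rule nn_integral_lim_restrict) simp
  also have "\<dots> = 1"
    by (subst prob_space.emeasure_space_1[OF prob_space_C, symmetric, of "\<lambda>_. undefined" 0 0])
      (simp_all add: space_PiM)
  finally show "emeasure PF.lim (space PF.lim) = 1" .
qed

end

section \<open>Dynamics under a stationary policy\<close>

lemma space_stateM [simp]: "space (stateM M) = states M"
  by (simp add: stateM_def space_restrict_space)

lemma space_actionM [simp]: "space (actionM M) = actions M"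
  by (simp add: actionM_def space_restrict_space)

lemma cost_measurable: "is_mdp M \<Longrightarrow> cost M \<in> borel_measurable (saM M)"
  and trans_kernel_measurable: "is_mdp M \<Longrightarrow> trans_kernel M \<in> saM M \<rightarrow>\<^sub>M prob_algebra (stateM M)"
  by (simp_all add: is_mdp_def)

lemma pol_kernel_open_loop:
  assumes "is_mdp M" "s \<in> states M" "a \<in> actions M"
  shows "pol_kernel M (open_loop M a) s = trans_kernel M (s, a)"
  unfolding pol_kernel_def open_loop_def
proof (rule bind_return)
  show "(\<lambda>a. trans_kernel M (s, a)) \<in> actionM M \<rightarrow>\<^sub>M subprob_algebra (stateM M)"
    using assms by (intro measurable_prob_algebraD measurable_compose[OF _ trans_kernel_measurable]) auto
qed (use assms in simp)

locale controlled_mdp =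
  fixes M :: "('s::polish_space, 'a::polish_space) mdp" and \<pi> :: "'s \<Rightarrow> 'a measure"
  assumes mdp: "is_mdp M" and policy: "\<pi> \<in> policies M"
begin

lemmas [measurable] = trans_kernel_measurable[OF mdp] cost_measurable[OF mdp]

lemma policy_measurable [measurable]: "\<pi> \<in> stateM M \<rightarrow>\<^sub>M prob_algebra (actionM M)"
  using policy by (simp add: policies_def)

lemma pol_kernel_measurable [measurable]:
  "pol_kernel M \<pi> \<in> stateM M \<rightarrow>\<^sub>M prob_algebra (stateM M)"
  unfolding pol_kernel_def[abs_def] by measurable

lemma sets_policy: "s \<in> states M \<Longrightarrow> sets (\<pi> s) = sets (actionM M)"
  and prob_space_policy: "s \<in> states M \<Longrightarrow> prob_space (\<pi> s)"
  using measurable_space[OF policy_measurable, of s] by (auto simp: space_prob_algebra)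

lemma space_pol_kernel:
  assumes "s \<in> states M"
  shows "space (pol_kernel M \<pi> s) = states M"
proof -
  have "sets (pol_kernel M \<pi> s) = sets (stateM M)"
    using measurable_space[OF pol_kernel_measurable, of s] assms by (simp add: space_prob_algebra)
  from sets_eq_imp_space_eq[OF this] show ?thesis by simp
qed

lemma sets_trans_kernel: "x \<in> space (saM M) \<Longrightarrow> sets (trans_kernel M x) = sets (stateM M)"
  using measurable_space[OF trans_kernel_measurable[OF mdp], of x] by (auto simp: space_prob_algebra)

lemma trans_kernel_section_measurable:
  assumes "s \<in> states M"
  shows "(\<lambda>a. trans_kernel M (s, a)) \<in> \<pi> s \<rightarrow>\<^sub>M subprob_algebra (stateM M)"
  unfolding measurable_cong_sets[OF sets_policy[OF assms] refl]
  using assms by (intro measurable_prob_algebraD) (auto intro!: measurable_compose[OF _ trans_kernel_measurable[OF mdp]])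

lemma nn_integral_pol_kernel:
  assumes "s \<in> states M" "f \<in> borel_measurable (stateM M)"
  shows "(\<integral>\<^sup>+s'. f s' \<partial>pol_kernel M \<pi> s) = (\<integral>\<^sup>+a. \<integral>\<^sup>+s'. f s' \<partial>trans_kernel M (s, a) \<partial>\<pi> s)"
  unfolding pol_kernel_def using trans_kernel_section_measurable[OF assms(1)] assms(2)
  by (subst nn_integral_bind[where B="stateM M"]) auto

lemma nn_integral_act:
  assumes s: "s \<in> states M" and g: "g \<in> borel_measurable (saM M)"
  shows "(\<integral>\<^sup>+x. g x \<partial>act M \<pi> s) = (\<integral>\<^sup>+a. g (s, a) \<partial>\<pi> s)"
proof -
  have "(\<lambda>a. (s, a)) \<in> \<pi> s \<rightarrow>\<^sub>M saM M"
    unfolding measurable_cong_sets[OF sets_policy[OF s] refl] using s by simp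
  then show ?thesis
    unfolding act_def using g by (subst nn_integral_distr) auto
qed

lemma policy_integral_measurable [measurable]:
  assumes [measurable]: "g \<in> borel_measurable (saM M)"
  shows "(\<lambda>s. \<integral>\<^sup>+a. g (s, a) \<partial>\<pi> s) \<in> borel_measurable (stateM M)"
  by (rule nn_integral_measurable_subprob_algebra2[where N="actionM M"])
    (auto intro: measurable_prob_algebraD)

lemma trans_integral_measurable [measurable]:
  assumes "f \<in> borel_measurable (stateM M)"
  shows "(\<lambda>x. \<integral>\<^sup>+s'. f s' \<partial>trans_kernel M x) \<in> borel_measurable (saM M)"
  by (rule measurable_compose[OF measurable_prob_algebraD[OF trans_kernel_measurable[OF mdp]]
        nn_integral_measurable_subprob_algebra[OF assms]])

lemma nn_integral_trajectory_0:
  assumes s: "s \<in> states M" and g[measurable]: "g \<in> borel_measurable (saM M)"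
  shows "(\<integral>\<^sup>+\<omega>. g (\<omega> 0) \<partial>trajectory M \<pi> s) = (\<integral>\<^sup>+a. g (s, a) \<partial>\<pi> s)"
proof -
  interpret IT: Ionescu_Tulcea "step_kernel M \<pi> s" "\<lambda>_. saM M"
    by (rule Ionescu_Tulcea_step_kernel[OF mdp policy s])
  interpret L: prob_space IT.PF.lim by (rule IT.prob_space_lim)
  have "(\<integral>\<^sup>+\<omega>. g (\<omega> 0) \<partial>trajectory M \<pi> s) = (\<integral>\<^sup>+\<omega>. (\<integral>\<^sup>+y. g y \<partial>act M \<pi> s) \<partial>IT.PF.lim)"
    unfolding trajectory_def using IT.nn_integral_lim_coordinate[of g 0] by simp
  then show ?thesis
    by (simp add: L.emeasure_space_1[simplified] nn_integral_act[OF s g])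
qed

text \<open>The Markov property at time \<open>n\<close>: the next pair is drawn by a transition from the current pair
followed by an action of the policy.\<close>

lemma nn_integral_trajectory_Suc_last:
  assumes s: "s \<in> states M" and g[measurable]: "g \<in> borel_measurable (saM M)"
  shows "(\<integral>\<^sup>+\<omega>. g (\<omega> (Suc n)) \<partial>trajectory M \<pi> s)
    = (\<integral>\<^sup>+\<omega>. (\<integral>\<^sup>+s'. \<integral>\<^sup>+a. g (s', a) \<partial>\<pi> s' \<partial>trans_kernel M (\<omega> n)) \<partial>trajectory M \<pi> s)"
proof -
  interpret IT: Ionescu_Tulcea "step_kernel M \<pi> s" "\<lambda>_. saM M"
    by (rule Ionescu_Tulcea_step_kernel[OF mdp policy s])
  have "(\<integral>\<^sup>+\<omega>. g (\<omega> (Suc n)) \<partial>trajectory M \<pi> s)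
      = (\<integral>\<^sup>+\<omega>. (\<integral>\<^sup>+y. g y \<partial>(trans_kernel M (\<omega> n) \<bind> act M \<pi>)) \<partial>trajectory M \<pi> s)"
    unfolding trajectory_def using IT.nn_integral_lim_coordinate[of g "Suc n"] by simp
  also have "\<dots> = (\<integral>\<^sup>+\<omega>. (\<integral>\<^sup>+s'. \<integral>\<^sup>+a. g (s', a) \<partial>\<pi> s' \<partial>trans_kernel M (\<omega> n)) \<partial>trajectory M \<pi> s)"
  proof (rule nn_integral_cong)
    fix \<omega> assume "\<omega> \<in> space (trajectory M \<pi> s)"
    then have \<omega>: "\<omega> n \<in> space (saM M)"
      by (auto simp: trajectory_def space_PiM PiE_iff)
    have "act M \<pi> \<in> trans_kernel M (\<omega> n) \<rightarrow>\<^sub>M subprob_algebra (saM M)"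
      unfolding measurable_cong_sets[OF sets_trans_kernel[OF \<omega>] refl]
      by (rule measurable_prob_algebraD[OF act_measurable[OF policy]])
    then have "(\<integral>\<^sup>+y. g y \<partial>(trans_kernel M (\<omega> n) \<bind> act M \<pi>))
        = (\<integral>\<^sup>+s'. \<integral>\<^sup>+y. g y \<partial>act M \<pi> s' \<partial>trans_kernel M (\<omega> n))"
      by (intro nn_integral_bind[OF g])
    also have "\<dots> = (\<integral>\<^sup>+s'. \<integral>\<^sup>+a. g (s', a) \<partial>\<pi> s' \<partial>trans_kernel M (\<omega> n))"
      using sets_eq_imp_space_eq[OF sets_trans_kernel[OF \<omega>]]
      by (intro nn_integral_cong nn_integral_act[OF _ g]) simp
    finally show "(\<integral>\<^sup>+y. g y \<partial>(trans_kernel M (\<omega> n) \<bind> act M \<pi>))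
        = (\<integral>\<^sup>+s'. \<integral>\<^sup>+a. g (s', a) \<partial>\<pi> s' \<partial>trans_kernel M (\<omega> n))" .
  qed
  finally show ?thesis .
qed

text \<open>The Markov property at time 0, for one coordinate: wait one step, then restart from the state
reached. The construction of the process appends transitions at the end, so this is obtained by
induction, moving the last transition into the integrand and applying the hypothesis to the
new integrand.\<close>

lemma nn_integral_trajectory_Suc_first:
  assumes s: "s \<in> states M" and g: "g \<in> borel_measurable (saM M)"
  shows "(\<integral>\<^sup>+\<omega>. g (\<omega> (Suc n)) \<partial>trajectory M \<pi> s)
    = (\<integral>\<^sup>+s'. \<integral>\<^sup>+\<omega>. g (\<omega> n) \<partial>trajectory M \<pi> s' \<partial>pol_kernel M \<pi> s)"
  using g
proof (induction n arbitrary: g)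
  case (0 g)
  note [measurable] = 0
  have "(\<integral>\<^sup>+\<omega>. g (\<omega> (Suc 0)) \<partial>trajectory M \<pi> s)
      = (\<integral>\<^sup>+a. \<integral>\<^sup>+s'. \<integral>\<^sup>+a'. g (s', a') \<partial>\<pi> s' \<partial>trans_kernel M (s, a) \<partial>\<pi> s)"
    using s by (subst nn_integral_trajectory_Suc_last) (auto intro: nn_integral_trajectory_0)
  also have "\<dots> = (\<integral>\<^sup>+s'. \<integral>\<^sup>+a'. g (s', a') \<partial>\<pi> s' \<partial>pol_kernel M \<pi> s)"
    using s by (intro nn_integral_pol_kernel[symmetric]) auto
  also have "\<dots> = (\<integral>\<^sup>+s'. \<integral>\<^sup>+\<omega>. g (\<omega> 0) \<partial>trajectory M \<pi> s' \<partial>pol_kernel M \<pi> s)"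
    using 0 by (intro nn_integral_cong nn_integral_trajectory_0[symmetric]) (simp add: space_pol_kernel[OF s])
  finally show ?case .
next
  case (Suc n g)
  note [measurable] = Suc.prems
  let ?L = "\<lambda>x. \<integral>\<^sup>+s'. \<integral>\<^sup>+a. g (s', a) \<partial>\<pi> s' \<partial>trans_kernel M x"
  have "(\<integral>\<^sup>+\<omega>. g (\<omega> (Suc (Suc n))) \<partial>trajectory M \<pi> s) = (\<integral>\<^sup>+\<omega>. ?L (\<omega> (Suc n)) \<partial>trajectory M \<pi> s)"
    by (rule nn_integral_trajectory_Suc_last[OF s Suc.prems])
  also have "\<dots> = (\<integral>\<^sup>+s'. \<integral>\<^sup>+\<omega>. ?L (\<omega> n) \<partial>trajectory M \<pi> s' \<partial>pol_kernel M \<pi> s)"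
    by (rule Suc.IH) measurable
  also have "\<dots> = (\<integral>\<^sup>+s'. \<integral>\<^sup>+\<omega>. g (\<omega> (Suc n)) \<partial>trajectory M \<pi> s' \<partial>pol_kernel M \<pi> s)"
    using Suc.prems by (intro nn_integral_cong nn_integral_trajectory_Suc_last[symmetric]) (simp_all add: space_pol_kernel[OF s])
  finally show ?case .
qed

lemma trajectory_integral_measurable [measurable]:
  assumes "g \<in> borel_measurable (saM M)"
  shows "(\<lambda>s. \<integral>\<^sup>+\<omega>. g (\<omega> n) \<partial>trajectory M \<pi> s) \<in> borel_measurable (stateM M)"
  using assms
proof (induction n arbitrary: g)
  case (0 g)
  note [measurable] = 0
  have "(\<lambda>s. \<integral>\<^sup>+a. g (s, a) \<partial>\<pi> s) \<in> borel_measurable (stateM M)"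
    by measurable
  then show ?case
    by (rule measurable_cong[THEN iffD1, rotated]) (auto simp: nn_integral_trajectory_0 0)
next
  case (Suc n g)
  note [measurable] = Suc.prems
  have "(\<lambda>s. \<integral>\<^sup>+\<omega>. (\<integral>\<^sup>+s'. \<integral>\<^sup>+a. g (s', a) \<partial>\<pi> s' \<partial>trans_kernel M (\<omega> n)) \<partial>trajectory M \<pi> s)
      \<in> borel_measurable (stateM M)"
    by (rule Suc.IH) measurable
  then show ?case
    by (rule measurable_cong[THEN iffD1, rotated]) (auto simp: nn_integral_trajectory_Suc_last Suc.prems)
qed

end

section \<open>State-action values and weighted bounds\<close>

text \<open>The drift condition is the kernel part of the stability of all open-loop policies. Averaging it
over actions gives the same drift for the kernel of every policy.\<close>

locale weighted_mdp =
  fixes M :: "('s::polish_space, 'a::polish_space) mdp" and w :: "'s \<Rightarrow> real" and \<kappa> cmin :: real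
  assumes mdp: "is_mdp M"
    and cost_ge: "\<And>s a. s \<in> states M \<Longrightarrow> a \<in> actions M \<Longrightarrow> cmin \<le> cost M (s, a)"
    and weight_ge_1: "\<And>s. s \<in> states M \<Longrightarrow> 1 \<le> w s"
    and kappa_pos: "0 < \<kappa>" and discount_kappa: "discount M * \<kappa> < 1"
    and drift: "\<And>s a. s \<in> states M \<Longrightarrow> a \<in> actions M \<Longrightarrow>
      (\<integral>\<^sup>+s'. ennreal (w s') \<partial>trans_kernel M (s, a)) \<le> ennreal (\<kappa> * w s)"
begin

definition weight_bounded :: "real \<Rightarrow> ('s \<Rightarrow> real) \<Rightarrow> bool" where
  "weight_bounded C f \<longleftrightarrow> (\<forall>s\<in>states M. \<bar>f s\<bar> \<le> C * w s)"

definition weighted_fun :: "('s \<Rightarrow> real) \<Rightarrow> bool" where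
  "weighted_fun u \<longleftrightarrow> u \<in> borel_measurable (stateM M) \<and> (\<exists>C\<ge>0. weight_bounded C u)"

text \<open>Contraction, model mismatch, infima and policy averages are all compared at the level of this
function of state and action.\<close>

definition q_value :: "('s \<Rightarrow> real) \<Rightarrow> 's \<Rightarrow> 'a \<Rightarrow> real" where
  "q_value v s a = cost M (s, a) + discount M * (\<integral>s'. v s' \<partial>trans_kernel M (s, a))"

lemma discount_pos: "0 < discount M" and discount_less_1: "discount M < 1"
  using mdp by (simp_all add: is_mdp_def)

lemma trans_kernel_in:
  assumes "s \<in> states M" "a \<in> actions M"
  shows "sets (trans_kernel M (s, a)) = sets (stateM M)" "space (trans_kernel M (s, a)) = states M"
    "prob_space (trans_kernel M (s, a))"
proof -
  from measurable_space[OF trans_kernel_measurable[OF mdp], of "(s, a)"] assms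
  show sets: "sets (trans_kernel M (s, a)) = sets (stateM M)" and "prob_space (trans_kernel M (s, a))"
    by (auto simp: space_pair_measure space_prob_algebra)
  show "space (trans_kernel M (s, a)) = states M"
    using sets_eq_imp_space_eq[OF sets] by simp
qed

lemma nn_integral_drift:
  assumes sa: "s \<in> states M" "a \<in> actions M" and f: "f \<in> borel_measurable (stateM M)"
    and C: "0 \<le> C" and le: "\<And>s'. s' \<in> states M \<Longrightarrow> f s' \<le> ennreal (C * w s')"
  shows "(\<integral>\<^sup>+s'. f s' \<partial>trans_kernel M (s, a)) \<le> ennreal (C * \<kappa> * w s)"
proof -
  have "(\<integral>\<^sup>+s'. f s' \<partial>trans_kernel M (s, a)) \<le> ennreal C * (\<integral>\<^sup>+s'. ennreal (w s') \<partial>trans_kernel M (s, a))"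
  proof (rule nn_integral_le_cmult[OF _ C])
    show "f \<in> borel_measurable (trans_kernel M (s, a))"
      unfolding measurable_cong_sets[OF trans_kernel_in(1)[OF sa] refl] by (rule f)
    show "f x \<le> ennreal C * ennreal (w x)" if "x \<in> space (trans_kernel M (s, a))" for x
      using le[of x] that C weight_ge_1[of x] unfolding trans_kernel_in(2)[OF sa]
      by (simp add: ennreal_mult)
  qed
  also have "\<dots> \<le> ennreal C * ennreal (\<kappa> * w s)"
    by (intro mult_left_mono drift sa) simp
  also have "\<dots> = ennreal (C * \<kappa> * w s)"
    using C kappa_pos weight_ge_1[OF sa(1)] by (simp add: ennreal_mult mult.assoc)
  finally show ?thesis .
qed

lemma weight_bounded_integrable:
  assumes sa: "s \<in> states M" "a \<in> actions M" and v: "v \<in> borel_measurable (stateM M)"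
    and C: "0 \<le> C" and bnd: "weight_bounded C v"
  shows "integrable (trans_kernel M (s, a)) v"
    and "\<bar>\<integral>s'. v s' \<partial>trans_kernel M (s, a)\<bar> \<le> C * \<kappa> * w s"
proof -
  have le: "(\<integral>\<^sup>+s'. ennreal \<bar>v s'\<bar> \<partial>trans_kernel M (s, a)) \<le> ennreal (C * \<kappa> * w s)"
    using bnd v by (intro nn_integral_drift sa C ennreal_leI) (auto simp: weight_bounded_def)
  show int: "integrable (trans_kernel M (s, a)) v"
  proof (rule integrableI_bounded)
    show "v \<in> borel_measurable (trans_kernel M (s, a))"
      unfolding measurable_cong_sets[OF trans_kernel_in(1)[OF sa] refl] by (rule v)
    show "(\<integral>\<^sup>+s'. ennreal (norm (v s')) \<partial>trans_kernel M (s, a)) < \<infinity>"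
      using le by (auto intro: le_less_trans)
  qed
  have nn: "0 \<le> C * \<kappa> * w s"
    using C kappa_pos weight_ge_1[OF sa(1)] by simp
  have "ennreal (\<integral>s'. \<bar>v s'\<bar> \<partial>trans_kernel M (s, a)) \<le> ennreal (C * \<kappa> * w s)"
    using le by (subst nn_integral_eq_integral[symmetric]) (auto simp: int)
  then have "(\<integral>s'. \<bar>v s'\<bar> \<partial>trans_kernel M (s, a)) \<le> C * \<kappa> * w s"
    using nn by simp
  then show "\<bar>\<integral>s'. v s' \<partial>trans_kernel M (s, a)\<bar> \<le> C * \<kappa> * w s"
    using integral_abs_bound[of "trans_kernel M (s, a)" v] by linarith
qed

lemma weighted_fun_integrable:
  "weighted_fun v \<Longrightarrow> s \<in> states M \<Longrightarrow> a \<in> actions M \<Longrightarrow> integrable (trans_kernel M (s, a)) v"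
  unfolding weighted_fun_def using weight_bounded_integrable(1) by blast

text \<open>The costs cancel, and the drift turns a bound \<open>C w\<close> on \<open>|u - v|\<close> into \<open>\<kappa> C w\<close> after integration.\<close>

lemma q_value_contraction:
  assumes sa: "s \<in> states M" "a \<in> actions M"
    and uv: "weighted_fun u" "weighted_fun v"
    and C: "0 \<le> C" "weight_bounded C (\<lambda>s. u s - v s)"
  shows "\<bar>q_value u s a - q_value v s a\<bar> \<le> discount M * \<kappa> * C * w s"
proof -
  have "q_value u s a - q_value v s a = discount M * (\<integral>s'. u s' - v s' \<partial>trans_kernel M (s, a))"
    unfolding q_value_def using weighted_fun_integrable[OF _ sa] uv by (simp add: algebra_simps)
  also have "\<bar>\<dots>\<bar> = discount M * \<bar>\<integral>s'. u s' - v s' \<partial>trans_kernel M (s, a)\<bar>"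
    using discount_pos by (simp add: abs_mult)
  also have "\<dots> \<le> discount M * (C * \<kappa> * w s)"
    using uv C discount_pos
    by (intro mult_left_mono weight_bounded_integrable(2)[OF sa]) (auto simp: weighted_fun_def)
  finally show ?thesis by (simp add: ac_simps)
qed

text \<open>Translates between the weighted norm and pointwise bounds. The weight is at least 1, so no
division by 0 occurs, and an infinite value of \<open>f\<close> makes both sides false.\<close>

lemma wnorm_le_iff:
  assumes "0 \<le> C"
  shows "wnorm M w f \<le> ennreal C \<longleftrightarrow> (\<forall>s\<in>states M. \<bar>f s\<bar> \<le> ereal (C * w s))"
proof -
  have "e2ennreal \<bar>f s\<bar> / ennreal (w s) \<le> ennreal C \<longleftrightarrow> \<bar>f s\<bar> \<le> ereal (C * w s)"
    if s: "s \<in> states M" for s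
  proof (cases "f s")
    case (real r)
    then show ?thesis
      using weight_ge_1[OF s] assms by (simp add: divide_ennreal pos_divide_le_eq)
  qed (simp_all add: ennreal_top_divide top_unique)
  then show ?thesis by (simp add: wnorm_def SUP_le_iff)
qed

text \<open>A finite weighted norm forces finite values on the state space.\<close>

lemma wval_space_real:
  assumes V: "V \<in> wval_space cmin w M"
  obtains v where "weighted_fun v" "\<And>s. s \<in> states M \<Longrightarrow> V s = ereal (v s)"
proof
  have meas: "V \<in> borel_measurable (stateM M)" and "wnorm M w V < \<infinity>"
    using V by (auto simp: wval_space_def val_space_def)
  then obtain C where C: "0 \<le> C" "wnorm M w V \<le> ennreal C"
    by (cases "wnorm M w V") auto
  then have V_le: "\<bar>V s\<bar> \<le> ereal (C * w s)" if "s \<in> states M" for s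
    using that by (simp add: wnorm_le_iff)
  show V_eq: "V s = ereal (real_of_ereal (V s))" if "s \<in> states M" for s
    using V_le[OF that] by (cases "V s") auto
  have "weight_bounded C (\<lambda>s. real_of_ereal (V s))"
    unfolding weight_bounded_def
  proof
    fix s assume "s \<in> states M"
    then show "\<bar>real_of_ereal (V s)\<bar> \<le> C * w s"
      using V_le[of s] by (cases "V s") auto
  qed
  with meas C show "weighted_fun (\<lambda>s. real_of_ereal (V s))"
    by (auto simp: weighted_fun_def)
qed

lemma bellman_opt_q_value:
  assumes s: "s \<in> states M" and v: "weighted_fun v" "\<And>s'. s' \<in> states M \<Longrightarrow> V s' = ereal (v s')"
  shows "bellman_opt M V s = (INF a\<in>actions M. ereal (q_value v s a))"
  unfolding bellman_opt_def
proof (rule INF_cong[OF refl])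
  fix a assume a: "a \<in> actions M"
  have "eint (trans_kernel M (s, a)) V = eint (trans_kernel M (s, a)) (\<lambda>s'. ereal (v s'))"
    by (rule eint_cong) (simp add: trans_kernel_in(2)[OF s a] v)
  also have "\<dots> = ereal (\<integral>s'. v s' \<partial>trans_kernel M (s, a))"
    by (rule eint_integrable[OF weighted_fun_integrable[OF v(1) s a]])
  finally show "ereal (cost M (s, a)) + ereal (discount M) * eint (trans_kernel M (s, a)) V
      = ereal (q_value v s a)"
    by (simp add: q_value_def)
qed

lemma bellman_pol_open_loop:
  assumes s: "s \<in> states M" and a: "a \<in> actions M"
    and v: "weighted_fun v" "\<And>s'. s' \<in> states M \<Longrightarrow> V s' = ereal (v s')"
  shows "bellman_pol M (open_loop M a) V s = ereal (q_value v s a)"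
proof -
  have [measurable]: "(\<lambda>a. cost M (s, a)) \<in> borel_measurable (actionM M)"
    using mdp s by (intro measurable_compose[OF _ cost_measurable[OF mdp]]) simp
  have "pol_cost M (open_loop M a) s = ereal (cost M (s, a))"
    unfolding pol_cost_def eint_def open_loop_def using a
    by (cases "0 \<le> cost M (s, a)") (auto simp: nn_integral_return ennreal_neg zero_ennreal.rep_eq)
  moreover have "eint (trans_kernel M (s, a)) V = eint (trans_kernel M (s, a)) (\<lambda>s'. ereal (v s'))"
    by (rule eint_cong) (simp add: trans_kernel_in(2)[OF s a] v)
  moreover have "\<dots> = ereal (\<integral>s'. v s' \<partial>trans_kernel M (s, a))"
    by (rule eint_integrable[OF weighted_fun_integrable[OF v(1) s a]])
  ultimately show ?thesis
    by (simp add: bellman_pol_def pol_kernel_open_loop[OF mdp s a] q_value_def)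
qed

end

section \<open>The value function of a stable policy\<close>

text \<open>Stability bounds the mean cost in the weighted norm. Measuring the cost from its lower bound
turns this into a bound on the integral of a nonnegative function.\<close>

locale stable_policy = weighted_mdp M w \<kappa> cmin + controlled_mdp M \<pi>
  for M :: "('s::polish_space, 'a::polish_space) mdp" and w :: "'s \<Rightarrow> real" and \<kappa> cmin :: real
    and \<pi> :: "'s \<Rightarrow> 'a measure" +
  fixes C0 :: real
  assumes C0_nonneg: "0 \<le> C0"
    and excess_cost: "\<And>s. s \<in> states M \<Longrightarrow>
      (\<integral>\<^sup>+a. ennreal (cost M (s, a) - cmin) \<partial>\<pi> s) \<le> ennreal (C0 * w s)"
begin

lemma space_policy: "s \<in> states M \<Longrightarrow> space (\<pi> s) = actions M"
  using sets_eq_imp_space_eq[OF sets_policy, of s] by simp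

lemma section_measurable:
  assumes s: "s \<in> states M" and g: "g \<in> saM M \<rightarrow>\<^sub>M N"
  shows "(\<lambda>a. g (s, a)) \<in> \<pi> s \<rightarrow>\<^sub>M N"
  unfolding measurable_cong_sets[OF sets_policy[OF s] refl]
  using s by (intro measurable_compose[OF _ g]) simp

lemma cost_integrable:
  assumes s: "s \<in> states M"
  shows "integrable (\<pi> s) (\<lambda>a. cost M (s, a))"
proof -
  interpret prob_space "\<pi> s" by (rule prob_space_policy[OF s])
  have "integrable (\<pi> s) (\<lambda>a. cost M (s, a) - cmin)"
    using excess_cost[OF s] cost_ge[OF s]
    by (intro integrableI_nonneg AE_I2 borel_measurable_diff section_measurable[OF s])
      (auto simp: space_policy[OF s] intro: le_less_trans)
  from Bochner_Integration.integrable_add[OF this, of "\<lambda>_. cmin"] show ?thesis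
    by simp
qed

lemma
  assumes s: "s \<in> states M" and wf: "weighted_fun v"
  shows q_value_integrable: "integrable (\<pi> s) (q_value v s)"
    and bellman_pol_q_value: "(\<And>s'. s' \<in> states M \<Longrightarrow> V s' = ereal (v s')) \<Longrightarrow>
      bellman_pol M \<pi> V s = ereal (\<integral>a. q_value v s a \<partial>\<pi> s)"
proof -
  interpret prob_space "\<pi> s" by (rule prob_space_policy[OF s])
  from wf obtain C where v: "v \<in> borel_measurable (stateM M)" and C: "0 \<le> C" "weight_bounded C v"
    by (auto simp: weighted_fun_def)
  have fin: "(\<integral>\<^sup>+a. \<integral>\<^sup>+s'. ennreal \<bar>v s'\<bar> \<partial>trans_kernel M (s, a) \<partial>\<pi> s) < \<infinity>"
  proof -
    have "(\<integral>\<^sup>+a. \<integral>\<^sup>+s'. ennreal \<bar>v s'\<bar> \<partial>trans_kernel M (s, a) \<partial>\<pi> s) \<le> (\<integral>\<^sup>+a. ennreal (C * \<kappa> * w s) \<partial>\<pi> s)"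
      using C v by (intro nn_integral_mono nn_integral_drift s ennreal_leI)
        (auto simp: space_policy[OF s] weight_bounded_def)
    also have "\<dots> < \<infinity>" by (simp add: emeasure_space_1)
    finally show ?thesis .
  qed
  note bind = integral_bind_integrable[OF trans_kernel_section_measurable[OF s] v fin
      weight_bounded_integrable(1)[OF s _ v C], folded pol_kernel_def]
  have i1: "integrable (\<pi> s) (\<lambda>a. discount M * (\<integral>s'. v s' \<partial>trans_kernel M (s, a)))"
    using bind(2) by (simp add: space_policy[OF s])
  show "integrable (\<pi> s) (q_value v s)"
    unfolding q_value_def[abs_def] using cost_integrable[OF s] i1 by simp
  assume V: "\<And>s'. s' \<in> states M \<Longrightarrow> V s' = ereal (v s')"
  have "eint (pol_kernel M \<pi> s) V = eint (pol_kernel M \<pi> s) (\<lambda>s'. ereal (v s'))"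
    by (rule eint_cong) (simp add: space_pol_kernel[OF s] V)
  also have "\<dots> = ereal (\<integral>a. \<integral>s'. v s' \<partial>trans_kernel M (s, a) \<partial>\<pi> s)"
    using bind by (simp add: eint_integrable space_policy[OF s])
  finally have "bellman_pol M \<pi> V s
      = ereal ((\<integral>a. cost M (s, a) \<partial>\<pi> s) + discount M * (\<integral>a. \<integral>s'. v s' \<partial>trans_kernel M (s, a) \<partial>\<pi> s))"
    unfolding bellman_pol_def pol_cost_def by (simp add: eint_integrable[OF cost_integrable[OF s]])
  also have "\<dots> = ereal (\<integral>a. q_value v s a \<partial>\<pi> s)"
    unfolding q_value_def using cost_integrable[OF s] i1 by simp
  finally show "bellman_pol M \<pi> V s = ereal (\<integral>a. q_value v s a \<partial>\<pi> s)" .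
qed

definition excess_at :: "nat \<Rightarrow> 's \<Rightarrow> ennreal" where
  "excess_at t s = (\<integral>\<^sup>+\<omega>. ennreal (cost M (\<omega> t) - cmin) \<partial>trajectory M \<pi> s)"

text \<open>The discounted cost in excess of \<open>cmin\<close>, as an extended nonnegative number. The value function
is this plus the constant \<open>cmin / (1 - \<gamma>)\<close>.\<close>

definition excess_value :: "'s \<Rightarrow> ennreal" where
  "excess_value s = (\<Sum>t. ennreal (discount M ^ t) * excess_at t s)"

lemma excess_at_measurable [measurable]: "excess_at t \<in> borel_measurable (stateM M)"
  unfolding excess_at_def[abs_def] by (rule trajectory_integral_measurable) measurable

lemma excess_value_measurable [measurable]: "excess_value \<in> borel_measurable (stateM M)"
  unfolding excess_value_def[abs_def] by measurable

lemma excess_at_0: "s \<in> states M \<Longrightarrow> excess_at 0 s = (\<integral>\<^sup>+a. ennreal (cost M (s, a) - cmin) \<partial>\<pi> s)"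
  unfolding excess_at_def by (rule nn_integral_trajectory_0) auto

lemma excess_at_Suc:
  assumes "s \<in> states M"
  shows "excess_at (Suc t) s = (\<integral>\<^sup>+a. \<integral>\<^sup>+s'. excess_at t s' \<partial>trans_kernel M (s, a) \<partial>\<pi> s)"
proof -
  have "excess_at (Suc t) s = (\<integral>\<^sup>+s'. excess_at t s' \<partial>pol_kernel M \<pi> s)"
    unfolding excess_at_def by (rule nn_integral_trajectory_Suc_first[OF assms]) measurable
  also have "\<dots> = (\<integral>\<^sup>+a. \<integral>\<^sup>+s'. excess_at t s' \<partial>trans_kernel M (s, a) \<partial>\<pi> s)"
    by (rule nn_integral_pol_kernel[OF assms]) measurable
  finally show ?thesis .
qed

text \<open>Each transition multiplies the bound by \<open>\<kappa>\<close>, by the drift condition.\<close>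

lemma excess_at_le: "s \<in> states M \<Longrightarrow> excess_at t s \<le> ennreal (C0 * \<kappa> ^ t * w s)"
proof (induction t arbitrary: s)
  case 0
  then show ?case using excess_cost by (simp add: excess_at_0)
next
  case (Suc t)
  interpret prob_space "\<pi> s" by (rule prob_space_policy[OF Suc.prems])
  have "excess_at (Suc t) s \<le> (\<integral>\<^sup>+a. ennreal (C0 * \<kappa> ^ t * \<kappa> * w s) \<partial>\<pi> s)"
    unfolding excess_at_Suc[OF Suc.prems]
    using C0_nonneg kappa_pos
    by (intro nn_integral_mono nn_integral_drift Suc.prems Suc.IH)
      (auto simp: space_policy[OF Suc.prems])
  then show ?case by (simp add: emeasure_space_1 ac_simps)
qed

text \<open>The terms are dominated by a geometric series with ratio \<open>\<gamma> \<kappa> < 1\<close>.\<close>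

lemma excess_value_le:
  assumes "s \<in> states M"
  shows "excess_value s \<le> ennreal (C0 / (1 - discount M * \<kappa>) * w s)"
proof -
  have w0: "0 \<le> w s" using weight_ge_1[OF assms] by simp
  have "excess_value s \<le> (\<Sum>t. ennreal (C0 * w s * (discount M * \<kappa>) ^ t))"
    unfolding excess_value_def
  proof (intro suminf_le summableI)
    fix t
    have "ennreal (discount M ^ t) * excess_at t s \<le> ennreal (discount M ^ t) * ennreal (C0 * \<kappa> ^ t * w s)"
      by (intro mult_left_mono excess_at_le assms) simp
    also have "\<dots> = ennreal (C0 * w s * (discount M * \<kappa>) ^ t)"
      using discount_pos kappa_pos C0_nonneg w0
      by (simp add: power_mult_distrib ac_simps flip: ennreal_mult)
    finally show "ennreal (discount M ^ t) * excess_at t s \<le> ennreal (C0 * w s * (discount M * \<kappa>) ^ t)" .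
  qed
  also have "\<dots> = ennreal (C0 * w s * (1 / (1 - discount M * \<kappa>)))"
    using discount_pos kappa_pos discount_kappa C0_nonneg w0
    by (intro suminf_ennreal_eq sums_mult geometric_sums) auto
  finally show ?thesis by simp
qed

text \<open>The Bellman equation of the policy for the excess cost: split off the term at time 0, prepend
one transition in all later terms, and sum under the integrals, which is allowed because
everything is nonnegative.\<close>

lemma excess_value_rec:
  assumes s: "s \<in> states M"
  shows "excess_value s = (\<integral>\<^sup>+a. ennreal (cost M (s, a) - cmin)
    + ennreal (discount M) * (\<integral>\<^sup>+s'. excess_value s' \<partial>trans_kernel M (s, a)) \<partial>\<pi> s)"
proof -
  have kernel_meas: "f \<in> borel_measurable (stateM M) \<Longrightarrow>
      (\<lambda>a. \<integral>\<^sup>+s'. f s' \<partial>trans_kernel M (s, a)) \<in> borel_measurable (\<pi> s)" for f :: "'s \<Rightarrow> ennreal"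
    by (rule section_measurable[OF s trans_integral_measurable])
  have "excess_value s = (\<Sum>t. ennreal (discount M ^ Suc t) * excess_at (Suc t) s) + excess_at 0 s"
    unfolding excess_value_def by (subst suminf_offset[where i=1]) (auto intro: summableI)
  also have "(\<Sum>t. ennreal (discount M ^ Suc t) * excess_at (Suc t) s)
      = (\<Sum>t. ennreal (discount M) * (\<integral>\<^sup>+a. \<integral>\<^sup>+s'. ennreal (discount M ^ t) * excess_at t s' \<partial>trans_kernel M (s, a) \<partial>\<pi> s))"
  proof (rule arg_cong[where f=suminf], rule ext)
    fix t
    have "(\<integral>\<^sup>+a. \<integral>\<^sup>+s'. ennreal (discount M ^ t) * excess_at t s' \<partial>trans_kernel M (s, a) \<partial>\<pi> s)
        = (\<integral>\<^sup>+a. ennreal (discount M ^ t) * (\<integral>\<^sup>+s'. excess_at t s' \<partial>trans_kernel M (s, a)) \<partial>\<pi> s)"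
      by (intro nn_integral_cong nn_integral_cmult)
        (simp add: space_policy[OF s] measurable_cong_sets[OF trans_kernel_in(1)[OF s] refl])
    also have "\<dots> = ennreal (discount M ^ t) * excess_at (Suc t) s"
      unfolding excess_at_Suc[OF s] by (intro nn_integral_cmult kernel_meas) measurable
    finally show "ennreal (discount M ^ Suc t) * excess_at (Suc t) s
        = ennreal (discount M) * (\<integral>\<^sup>+a. \<integral>\<^sup>+s'. ennreal (discount M ^ t) * excess_at t s' \<partial>trans_kernel M (s, a) \<partial>\<pi> s)"
      using discount_pos by (simp add: ennreal_mult mult.assoc)
  qed
  also have "\<dots> = ennreal (discount M) * (\<Sum>t. \<integral>\<^sup>+a. \<integral>\<^sup>+s'. ennreal (discount M ^ t) * excess_at t s' \<partial>trans_kernel M (s, a) \<partial>\<pi> s)"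
    by simp
  also have "(\<Sum>t. \<integral>\<^sup>+a. \<integral>\<^sup>+s'. ennreal (discount M ^ t) * excess_at t s' \<partial>trans_kernel M (s, a) \<partial>\<pi> s)
      = (\<integral>\<^sup>+a. (\<Sum>t. \<integral>\<^sup>+s'. ennreal (discount M ^ t) * excess_at t s' \<partial>trans_kernel M (s, a)) \<partial>\<pi> s)"
    by (intro nn_integral_suminf[symmetric] kernel_meas) measurable
  also have "\<dots> = (\<integral>\<^sup>+a. \<integral>\<^sup>+s'. excess_value s' \<partial>trans_kernel M (s, a) \<partial>\<pi> s)"
    unfolding excess_value_def
    by (intro nn_integral_cong nn_integral_suminf[symmetric])
      (simp add: space_policy[OF s] measurable_cong_sets[OF trans_kernel_in(1)[OF s] refl])
  also have "ennreal (discount M) * \<dots> + excess_at 0 s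
      = (\<integral>\<^sup>+a. ennreal (cost M (s, a) - cmin)
        + ennreal (discount M) * (\<integral>\<^sup>+s'. excess_value s' \<partial>trans_kernel M (s, a)) \<partial>\<pi> s)"
    using section_measurable[OF s cost_measurable[OF mdp]] kernel_meas[OF excess_value_measurable]
    by (simp add: excess_at_0[OF s] nn_integral_add nn_integral_cmult add.commute)
  finally show ?thesis .
qed

lemma prob_space_trajectory:
  assumes s: "s \<in> states M"
  shows "prob_space (trajectory M \<pi> s)"
proof -
  interpret IT: Ionescu_Tulcea "step_kernel M \<pi> s" "\<lambda>_. saM M"
    by (rule Ionescu_Tulcea_step_kernel[OF mdp policy s])
  show ?thesis unfolding trajectory_def by (rule IT.prob_space_lim)
qed

lemma sets_trajectory:
  assumes "s \<in> states M"
  shows "sets (trajectory M \<pi> s) = sets (PiM UNIV (\<lambda>_. saM M))"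
proof -
  interpret IT: Ionescu_Tulcea "step_kernel M \<pi> s" "\<lambda>_. saM M"
    by (rule Ionescu_Tulcea_step_kernel[OF mdp policy assms])
  show ?thesis unfolding trajectory_def by (rule IT.PF.sets_lim)
qed

text \<open>On each path the discounted costs are the excess costs plus the series of \<open>cmin \<gamma>\<^sup>t\<close>. The first
series may diverge to \<open>\<infinity>\<close> and the second converges, so the sum of limits is meaningful.\<close>

lemma value_fun_excess:
  assumes s: "s \<in> states M"
  shows "value_fun M \<pi> s = enn2ereal (excess_value s) + ereal (cmin / (1 - discount M))"
proof -
  let ?g = "\<lambda>\<omega>. \<Sum>t. ennreal (discount M ^ t) * ennreal (cost M (\<omega> t) - cmin)"
  have comp: "f \<in> borel_measurable (saM M) \<Longrightarrow> (\<lambda>\<omega>. f (\<omega> t)) \<in> borel_measurable (trajectory M \<pi> s)"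
    for f :: "'s \<times> 'a \<Rightarrow> ennreal" and t
    unfolding measurable_cong_sets[OF sets_trajectory[OF s] refl]
    by (rule measurable_compose[OF measurable_component_singleton]) auto
  have meas: "(\<lambda>\<omega>. ennreal (cost M (\<omega> t) - cmin)) \<in> borel_measurable (trajectory M \<pi> s)" for t
    by (rule comp) measurable
  have "value_fun M \<pi> s = enn2ereal (\<integral>\<^sup>+\<omega>. ?g \<omega> \<partial>trajectory M \<pi> s) + ereal (cmin / (1 - discount M))"
    unfolding value_fun_def
  proof (rule eint_add_const[OF prob_space_trajectory[OF s]])
    show "?g \<in> borel_measurable (trajectory M \<pi> s)"
      using meas by measurable
    fix \<omega> assume "\<omega> \<in> space (trajectory M \<pi> s)"
    then have "\<omega> \<in> space (PiM UNIV (\<lambda>_. saM M))"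
      using sets_eq_imp_space_eq[OF sets_trajectory[OF s]] by simp
    then have \<omega>: "cmin \<le> cost M (\<omega> t)" for t
      using cost_ge[of "fst (\<omega> t)" "snd (\<omega> t)"]
      by (auto simp: space_PiM PiE_iff space_pair_measure mem_Times_iff)
    have sum: "(\<Sum>t<n. ereal (discount M ^ t * cost M (\<omega> t)))
        = enn2ereal (\<Sum>t<n. ennreal (discount M ^ t) * ennreal (cost M (\<omega> t) - cmin))
          + ereal (\<Sum>t<n. cmin * discount M ^ t)" for n
    proof -
      have "(\<Sum>t<n. ennreal (discount M ^ t) * ennreal (cost M (\<omega> t) - cmin))
          = ennreal (\<Sum>t<n. discount M ^ t * (cost M (\<omega> t) - cmin))"
        using discount_pos \<omega> by (subst sum_ennreal[symmetric]) (auto simp: ennreal_mult)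
      moreover have "0 \<le> (\<Sum>t<n. discount M ^ t * (cost M (\<omega> t) - cmin))"
        using discount_pos \<omega> by (intro sum_nonneg) auto
      ultimately show ?thesis
        by (simp add: sum.distrib[symmetric] algebra_simps)
    qed
    have "(\<lambda>n. \<Sum>t<n. ennreal (discount M ^ t) * ennreal (cost M (\<omega> t) - cmin)) \<longlonglongrightarrow> ?g \<omega>"
      by (intro summable_LIMSEQ summableI)
    then have l1: "(\<lambda>n. enn2ereal (\<Sum>t<n. ennreal (discount M ^ t) * ennreal (cost M (\<omega> t) - cmin)))
        \<longlonglongrightarrow> enn2ereal (?g \<omega>)"
      by (rule tendsto_enn2erealI)
    have "(\<lambda>t. cmin * discount M ^ t) sums (cmin * (1 / (1 - discount M)))"
      using discount_pos discount_less_1 by (intro sums_mult geometric_sums) simp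
    then have l2: "(\<lambda>n. ereal (\<Sum>t<n. cmin * discount M ^ t)) \<longlonglongrightarrow> ereal (cmin / (1 - discount M))"
      by (simp add: sums_def)
    have "(\<lambda>t. ereal (discount M ^ t * cost M (\<omega> t))) sums (enn2ereal (?g \<omega>) + ereal (cmin / (1 - discount M)))"
      unfolding sums_def sum by (rule tendsto_add_ereal_general[OF _ l1 l2]) auto
    then show "(\<Sum>t. ereal (discount M ^ t * cost M (\<omega> t)))
        = enn2ereal (?g \<omega>) + ereal (cmin / (1 - discount M))"
      by (rule sums_unique[symmetric])
  qed
  also have "(\<integral>\<^sup>+\<omega>. ?g \<omega> \<partial>trajectory M \<pi> s) = excess_value s"
    unfolding excess_value_def excess_at_def
    using meas by (simp add: nn_integral_suminf nn_integral_cmult)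
  finally show ?thesis .
qed

text \<open>The weighted bound on the excess cost makes every integral in its recursion finite. Adding back
the value of the constant cost \<open>cmin\<close> then turns that recursion into the Bellman equation of the
policy for real functions, where distances can be estimated.\<close>

lemma value_fun_real:
  obtains x where "weighted_fun x"
    "\<And>s. s \<in> states M \<Longrightarrow> value_fun M \<pi> s = ereal (x s)"
    "\<And>s. s \<in> states M \<Longrightarrow> x s = (\<integral>a. q_value x s a \<partial>\<pi> s)"
proof -
  define m where "m = cmin / (1 - discount M)"
  define C1 where "C1 = C0 / (1 - discount M * \<kappa>)"
  define y where "y s = enn2real (excess_value s)" for s
  define x where "x s = y s + m" for s
  have C1: "0 \<le> C1" using C0_nonneg discount_kappa by (simp add: C1_def)
  \<comment> \<open>The constant \<open>m\<close> is the value of the constant cost \<open>cmin\<close>, so subtracting it from a fixed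
    point equation for \<open>c\<close> leaves one for \<open>c - cmin\<close>.\<close>
  have m: "cmin + discount M * m = m"
    using discount_less_1 by (simp add: m_def field_simps)
  have exc: "excess_value s = ennreal (y s)" if "s \<in> states M" for s
    using le_less_trans[OF excess_value_le[OF that]] unfolding y_def by simp
  have y: "0 \<le> y s" for s by (simp add: y_def)
  have y_le: "y s \<le> C1 * w s" if "s \<in> states M" for s
    using excess_value_le[OF that] weight_ge_1[OF that] C1 unfolding exc[OF that] C1_def[symmetric]
    by (subst (asm) ennreal_le_iff) auto
  have [measurable]: "y \<in> borel_measurable (stateM M)"
    unfolding y_def[abs_def] by measurable
  have x_meas: "x \<in> borel_measurable (stateM M)"
    unfolding x_def[abs_def] by measurable
  have y_bnd: "weight_bounded C1 y"
    using y y_le by (simp add: weight_bounded_def)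
  have x_bnd: "weight_bounded (C1 + \<bar>m\<bar>) x"
    unfolding weight_bounded_def
  proof
    fix s assume s: "s \<in> states M"
    \<comment> \<open>Constants are bounded by multiples of the weight because it is at least 1.\<close>
    have "\<bar>m\<bar> \<le> \<bar>m\<bar> * w s" using weight_ge_1[OF s] mult_left_mono[of 1 "w s" "\<bar>m\<bar>"] by simp
    then show "\<bar>x s\<bar> \<le> (C1 + \<bar>m\<bar>) * w s"
      using y[of s] y_le[OF s] by (simp add: x_def distrib_right)
  qed
  have x: "weighted_fun x"
    using x_meas x_bnd C1 by (auto simp: weighted_fun_def intro!: exI[of _ "C1 + \<bar>m\<bar>"])
  have fixpoint: "x s = (\<integral>a. q_value x s a \<partial>\<pi> s)" if s: "s \<in> states M" for s
  proof -
    interpret prob_space "\<pi> s" by (rule prob_space_policy[OF s])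
    have q: "integrable (\<pi> s) (q_value x s)"
      by (rule q_value_integrable[OF s x])
    have pw: "ennreal (cost M (s, a) - cmin)
          + ennreal (discount M) * (\<integral>\<^sup>+s'. excess_value s' \<partial>trans_kernel M (s, a))
        = ennreal (q_value x s a - m)"
      and nonneg: "0 \<le> q_value x s a - m" if a: "a \<in> actions M" for a
    proof -
      interpret K: prob_space "trans_kernel M (s, a)" by (rule trans_kernel_in(3)[OF s a])
      have int: "integrable (trans_kernel M (s, a)) y"
        using C1 y_bnd by (intro weight_bounded_integrable(1)[OF s a]) auto
      have "(\<integral>\<^sup>+s'. excess_value s' \<partial>trans_kernel M (s, a)) = (\<integral>\<^sup>+s'. ennreal (y s') \<partial>trans_kernel M (s, a))"
        by (intro nn_integral_cong exc) (simp add: trans_kernel_in(2)[OF s a])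
      also have "\<dots> = ennreal (\<integral>s'. y s' \<partial>trans_kernel M (s, a))"
        using int y by (intro nn_integral_eq_integral) auto
      finally have nn: "(\<integral>\<^sup>+s'. excess_value s' \<partial>trans_kernel M (s, a))
        = ennreal (\<integral>s'. y s' \<partial>trans_kernel M (s, a))" .
      have "q_value x s a - m = cost M (s, a) - cmin + discount M * (\<integral>s'. y s' \<partial>trans_kernel M (s, a))"
        using int m by (simp add: q_value_def x_def[abs_def] K.prob_space algebra_simps)
      moreover have "0 \<le> (\<integral>s'. y s' \<partial>trans_kernel M (s, a))"
        using y by simp
      ultimately show "ennreal (cost M (s, a) - cmin)
          + ennreal (discount M) * (\<integral>\<^sup>+s'. excess_value s' \<partial>trans_kernel M (s, a))
          = ennreal (q_value x s a - m)" "0 \<le> q_value x s a - m"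
        using cost_ge[OF s a] discount_pos
        by (simp_all add: nn flip: ennreal_mult ennreal_plus)
    qed
    have "ennreal (y s) = (\<integral>\<^sup>+a. ennreal (q_value x s a - m) \<partial>\<pi> s)"
      unfolding exc[OF s, symmetric] excess_value_rec[OF s]
      by (intro nn_integral_cong pw) (simp add: space_policy[OF s])
    also have "\<dots> = ennreal (\<integral>a. q_value x s a - m \<partial>\<pi> s)"
      using q nonneg by (intro nn_integral_eq_integral AE_I2) (auto simp: space_policy[OF s])
    finally have "y s = (\<integral>a. q_value x s a - m \<partial>\<pi> s)"
      using y[of s] nonneg by (subst (asm) ennreal_inj) (auto intro!: integral_nonneg_AE AE_I2 simp: space_policy[OF s])
    also have "\<dots> = (\<integral>a. q_value x s a \<partial>\<pi> s) - m"
      using q by (simp add: prob_space)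
    finally show ?thesis by (simp add: x_def)
  qed
  have "value_fun M \<pi> s = ereal (x s)" if "s \<in> states M" for s
    using value_fun_excess[OF that] y[of s] by (simp add: exc[OF that] x_def m_def)
  from x this fixpoint show thesis
    by (rule that)
qed

end

text \<open>Finiteness of the weighted norm of the mean cost bounds the mean excess cost as well, since
\<open>|cmin| \<le> |cmin| w\<close>.\<close>

lemma (in weighted_mdp) stable_policy_if_mem:
  assumes \<pi>: "\<pi> \<in> stable_policies \<kappa> w M"
  obtains C0 where "stable_policy M w \<kappa> cmin \<pi> C0"
proof -
  interpret controlled_mdp M \<pi>
    using \<pi> mdp by unfold_locales (auto simp: stable_policies_def)
  have "wnorm M w (pol_cost M \<pi>) < \<infinity>"
    using \<pi> by (simp add: stable_policies_def)
  then obtain C where C: "0 \<le> C" "wnorm M w (pol_cost M \<pi>) \<le> ennreal C"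
    by (cases "wnorm M w (pol_cost M \<pi>)") auto
  have "(\<integral>\<^sup>+a. ennreal (cost M (s, a) - cmin) \<partial>\<pi> s) \<le> ennreal ((C + \<bar>cmin\<bar>) * w s)"
    if s: "s \<in> states M" for s
  proof -
    let ?I = "\<integral>\<^sup>+a. ennreal (cost M (s, a) - cmin) \<partial>\<pi> s"
    have sp: "space (\<pi> s) = actions M"
      using sets_eq_imp_space_eq[OF sets_policy[OF s]] by simp
    have [measurable]: "(\<lambda>a. cost M (s, a)) \<in> borel_measurable (\<pi> s)"
      unfolding measurable_cong_sets[OF sets_policy[OF s] refl]
      using s by (intro measurable_compose[OF _ cost_measurable[OF mdp]]) simp
    have "pol_cost M \<pi> s = enn2ereal ?I + ereal cmin"
      unfolding pol_cost_def
      by (rule eint_add_const[OF prob_space_policy[OF s]]) (auto simp: sp cost_ge[OF s])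
    moreover have "\<bar>pol_cost M \<pi> s\<bar> \<le> ereal (C * w s)"
      using C s by (simp add: wnorm_le_iff)
    moreover have "\<bar>cmin\<bar> \<le> \<bar>cmin\<bar> * w s"
      using weight_ge_1[OF s] mult_left_mono[of 1 "w s" "\<bar>cmin\<bar>"] by simp
    ultimately show ?thesis
      by (cases ?I) (auto simp: distrib_right intro!: ennreal_leI simp del: ennreal_plus)
  qed
  then have "stable_policy M w \<kappa> cmin \<pi> (C + \<bar>cmin\<bar>)"
    using C(1) by unfold_locales auto
  then show thesis by (rule that)
qed

section \<open>Comparison of two models\<close>

locale mdp_pair = A: weighted_mdp M w \<kappa> cmin + B: weighted_mdp Mh w \<kappa> cmin
  for M Mh :: "('s::polish_space, 'a::polish_space) mdp" and w :: "'s \<Rightarrow> real" and \<kappa> cmin :: real +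
  assumes same_states: "states Mh = states M" and same_actions: "actions Mh = actions M"
    and same_discount: "discount Mh = discount M"
begin

abbreviation rate :: real where
  "rate \<equiv> discount M * \<kappa>"

text \<open>A pointwise form of the statement that the mismatch at \<open>u\<close> is at most \<open>d\<close>.\<close>

definition q_gap :: "real \<Rightarrow> ('s \<Rightarrow> real) \<Rightarrow> bool" where
  "q_gap d u \<longleftrightarrow> (\<forall>s\<in>states M. \<forall>a\<in>actions M. \<bar>A.q_value u s a - B.q_value u s a\<bar> \<le> d * w s)"

lemma rate_pos: "0 < rate" and rate_less_1: "rate < 1"
  using A.discount_pos A.kappa_pos A.discount_kappa by simp_all

lemma weighted_fun_eq: "B.weighted_fun u = A.weighted_fun u"
  by (simp add: A.weighted_fun_def B.weighted_fun_def A.weight_bounded_def B.weight_bounded_def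
      stateM_def same_states)

lemma weighted_fun_diff_bounded:
  assumes "A.weighted_fun u" "A.weighted_fun v"
  obtains C where "0 \<le> C" "A.weight_bounded C (\<lambda>s. u s - v s)"
proof -
  from assms obtain C1 C2 where C: "0 \<le> C1" "A.weight_bounded C1 u" "0 \<le> C2" "A.weight_bounded C2 v"
    by (auto simp: A.weighted_fun_def)
  have "A.weight_bounded (C1 + C2) (\<lambda>s. u s - v s)"
    unfolding A.weight_bounded_def
  proof
    fix s assume "s \<in> states M"
    then have "\<bar>u s\<bar> \<le> C1 * w s" "\<bar>v s\<bar> \<le> C2 * w s"
      using C by (auto simp: A.weight_bounded_def)
    then show "\<bar>u s - v s\<bar> \<le> (C1 + C2) * w s" by (simp add: distrib_right)
  qed
  with C that[of "C1 + C2"] show thesis by simp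
qed

text \<open>Either go from \<open>u\<close> to \<open>v\<close> in the first model and then change the model at \<open>v\<close>, or change the
model at \<open>u\<close> and then go from \<open>u\<close> to \<open>v\<close> in the second. This choice is why the distance of the
optimal values is controlled by the mismatch at either of them.\<close>

lemma q_value_diff_le:
  assumes sa: "s \<in> states M" "a \<in> actions M" and uv: "A.weighted_fun u" "A.weighted_fun v"
    and C: "0 \<le> C" "A.weight_bounded C (\<lambda>s. u s - v s)" and gap: "q_gap d u \<or> q_gap d v"
  shows "\<bar>A.q_value u s a - B.q_value v s a\<bar> \<le> (rate * C + d) * w s"
proof -
  have "\<bar>A.q_value u s a - A.q_value v s a\<bar> \<le> rate * C * w s"
    by (rule A.q_value_contraction[OF sa uv C])
  moreover have "\<bar>B.q_value u s a - B.q_value v s a\<bar> \<le> rate * C * w s"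
    using B.q_value_contraction[of s a u v C] sa uv C
    by (simp add: weighted_fun_eq same_states same_actions same_discount
        A.weight_bounded_def B.weight_bounded_def)
  ultimately show ?thesis
    using gap sa unfolding q_gap_def distrib_right by (smt (verit))
qed

text \<open>The premise \<open>mono\<close> expresses that \<open>u\<close> and \<open>v\<close> arise from their state-action values by an
operation that does not increase distances: an infimum over actions or an average over them.\<close>

lemma fixpoint_gap:
  assumes wf: "A.weighted_fun u" "A.weighted_fun v" and d: "0 \<le> d" and gap: "q_gap d u \<or> q_gap d v"
    and mono: "\<And>s e. s \<in> states M \<Longrightarrow>
      (\<And>a. a \<in> actions M \<Longrightarrow> \<bar>A.q_value u s a - B.q_value v s a\<bar> \<le> e) \<Longrightarrow> \<bar>u s - v s\<bar> \<le> e"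
  shows "A.weight_bounded (d / (1 - rate)) (\<lambda>s. u s - v s)"
proof -
  obtain C0 where C0: "0 \<le> C0" "A.weight_bounded C0 (\<lambda>s. u s - v s)"
    using weighted_fun_diff_bounded[OF wf] .
  show ?thesis
    unfolding A.weight_bounded_def
  proof
    fix s assume s: "s \<in> states M"
    show "\<bar>u s - v s\<bar> \<le> d / (1 - rate) * w s"
    proof (rule contraction_bound[where S="states M" and e="\<lambda>s. \<bar>u s - v s\<bar>"])
      fix C s assume C: "0 \<le> C" "\<And>s. s \<in> states M \<Longrightarrow> \<bar>u s - v s\<bar> \<le> C * w s" and s: "s \<in> states M"
      then have "A.weight_bounded C (\<lambda>s. u s - v s)"
        by (simp add: A.weight_bounded_def)
      then show "\<bar>u s - v s\<bar> \<le> (rate * C + d) * w s"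
        using q_value_diff_le[OF s _ wf C(1) _ gap] by (intro mono[OF s])
    next
      show "0 \<le> w s" if "s \<in> states M" for s using A.weight_ge_1[OF that] by simp
    qed (use C0 s d rate_pos rate_less_1 in \<open>auto simp: A.weight_bounded_def\<close>)
  qed
qed

lemma optimal_value_gap:
  assumes v: "A.weighted_fun v" "\<And>s. s \<in> states M \<Longrightarrow> ereal (v s) = (INF a\<in>actions M. ereal (A.q_value v s a))"
    and vh: "A.weighted_fun vh" "\<And>s. s \<in> states M \<Longrightarrow> ereal (vh s) = (INF a\<in>actions M. ereal (B.q_value vh s a))"
    and d: "0 \<le> d" and gap: "q_gap d v \<or> q_gap d vh"
  shows "A.weight_bounded (d / (1 - rate)) (\<lambda>s. v s - vh s)"
  by (rule fixpoint_gap[OF v(1) vh(1) d gap]) (rule abs_INF_diff_le[OF v(2) vh(2)])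

end

text \<open>Here \<open>x\<close> is the value of \<open>\<pi>\<close> in the first model, \<open>v\<close> and \<open>vh\<close> are the optimal values, and \<open>\<pi>\<close> is
greedy for \<open>vh\<close> in the second model. The functions enter only through their fixed point
equations.\<close>

locale policy_pair = mdp_pair M Mh w \<kappa> cmin
    + A: stable_policy M w \<kappa> cmin \<pi> C1 + B: stable_policy Mh w \<kappa> cmin \<pi> C2
  for M Mh :: "('s::polish_space, 'a::polish_space) mdp" and w :: "'s \<Rightarrow> real" and \<kappa> cmin :: real
    and \<pi> :: "'s \<Rightarrow> 'a measure" and C1 C2 :: real +
  fixes x v vh :: "'s \<Rightarrow> real" and d :: real
  assumes x: "A.weighted_fun x" "\<And>s. s \<in> states M \<Longrightarrow> x s = (\<integral>a. A.q_value x s a \<partial>\<pi> s)"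
    and v: "A.weighted_fun v" "\<And>s. s \<in> states M \<Longrightarrow> ereal (v s) = (INF a\<in>actions M. ereal (A.q_value v s a))"
    and vh: "A.weighted_fun vh" "\<And>s. s \<in> states M \<Longrightarrow> ereal (vh s) = (INF a\<in>actions M. ereal (B.q_value vh s a))"
    and greedy: "\<And>s. s \<in> states M \<Longrightarrow> vh s = (\<integral>a. B.q_value vh s a \<partial>\<pi> s)"
    and d: "0 \<le> d"
begin

lemma integral_q_diff_le:
  assumes s: "s \<in> states M" and u: "A.weighted_fun u" "A.weighted_fun u'"
    and le: "\<And>a. a \<in> actions M \<Longrightarrow> \<bar>A.q_value u s a - B.q_value u' s a\<bar> \<le> e"
  shows "\<bar>(\<integral>a. A.q_value u s a \<partial>\<pi> s) - (\<integral>a. B.q_value u' s a \<partial>\<pi> s)\<bar> \<le> e"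
proof (rule prob_space.abs_integral_diff_le[OF A.prob_space_policy[OF s]])
  show "integrable (\<pi> s) (A.q_value u s)" by (rule A.q_value_integrable[OF s u(1)])
  show "integrable (\<pi> s) (B.q_value u' s)"
    using s u(2) by (intro B.q_value_integrable) (simp_all add: same_states weighted_fun_eq)
qed (simp add: A.space_policy[OF s] le)

text \<open>Both \<open>x\<close> and \<open>v\<close> are within \<open>d / (1 - \<rho>)\<close> of \<open>vh\<close>, where \<open>\<rho>\<close> is the rate.\<close>

lemma regret_le_gap_at_model_optimum:
  assumes gap: "q_gap d vh"
  shows "A.weight_bounded (2 / (1 - rate) * d) (\<lambda>s. x s - v s)"
proof -
  have "A.weight_bounded (d / (1 - rate)) (\<lambda>s. x s - vh s)"
  proof (rule fixpoint_gap[OF x(1) vh(1) d])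
    fix s e assume s: "s \<in> states M"
      and "\<And>a. a \<in> actions M \<Longrightarrow> \<bar>A.q_value x s a - B.q_value vh s a\<bar> \<le> e"
    from integral_q_diff_le[OF s x(1) vh(1) this(2)] show "\<bar>x s - vh s\<bar> \<le> e"
      using s by (simp flip: x(2) greedy)
  qed (use gap in simp)
  moreover have "A.weight_bounded (d / (1 - rate)) (\<lambda>s. v s - vh s)"
    using gap by (intro optimal_value_gap v vh d) auto
  moreover have "2 / (1 - rate) * d * y = d / (1 - rate) * y + d / (1 - rate) * y" for y
    by simp
  ultimately show ?thesis
    unfolding A.weight_bounded_def by (smt (verit))
qed

text \<open>The gap is known at \<open>v\<close> and the policy is greedy at \<open>vh\<close>, so the comparison passes between the
two twice, once inside the state-action values and once outside. This doubles the defect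
\<open>d / (1 - \<rho>)\<close> of the contraction, with \<open>\<rho>\<close> the rate, and resolving the contraction contributes the
second factor \<open>1 / (1 - \<rho>)\<close>.\<close>

lemma regret_le_gap_at_true_optimum:
  assumes gap: "q_gap d v"
  shows "A.weight_bounded (2 / (1 - rate)\<^sup>2 * d) (\<lambda>s. x s - v s)"
proof -
  let ?D = "d / (1 - rate)"
  have D: "0 \<le> ?D" using d rate_less_1 by simp
  have vvh: "A.weight_bounded ?D (\<lambda>s. v s - vh s)"
    using gap by (intro optimal_value_gap v vh d) auto
  obtain C0 where C0: "0 \<le> C0" "A.weight_bounded C0 (\<lambda>s. x s - v s)"
    using weighted_fun_diff_bounded[OF x(1) v(1)] .
  \<comment> \<open>The model defect \<open>d\<close> is \<open>(1 - rate) * ?D\<close>, so the three error terms add up to \<open>2 * ?D\<close>.\<close>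
  have "(1 - rate) * ?D = d"
    using rate_less_1 by simp
  then have "?D - rate * ?D = d"
    by (simp only: left_diff_distrib mult_1)
  then have two_D: "rate * ?D + d + ?D = 2 * ?D"
    by linarith
  have const: "2 * ?D / (1 - rate) = 2 / (1 - rate)\<^sup>2 * d"
    by (simp add: power2_eq_square)
  show ?thesis
    unfolding A.weight_bounded_def const[symmetric]
  proof
    fix s assume s: "s \<in> states M"
    show "\<bar>x s - v s\<bar> \<le> 2 * ?D / (1 - rate) * w s"
    proof (rule contraction_bound[where S="states M" and e="\<lambda>s. \<bar>x s - v s\<bar>"])
      fix C s assume C: "0 \<le> C" "\<And>s. s \<in> states M \<Longrightarrow> \<bar>x s - v s\<bar> \<le> C * w s" and s: "s \<in> states M"
      then have xv: "A.weight_bounded C (\<lambda>s. x s - v s)"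
        by (simp add: A.weight_bounded_def)
      have "\<bar>(\<integral>a. A.q_value x s a \<partial>\<pi> s) - (\<integral>a. B.q_value vh s a \<partial>\<pi> s)\<bar> \<le> rate * C * w s + (rate * ?D + d) * w s"
      proof (rule integral_q_diff_le[OF s x(1) vh(1)])
        fix a assume a: "a \<in> actions M"
        have "\<bar>A.q_value x s a - A.q_value v s a\<bar> \<le> rate * C * w s"
          by (rule A.q_value_contraction[OF s a x(1) v(1) C(1) xv])
        moreover have "\<bar>A.q_value v s a - B.q_value vh s a\<bar> \<le> (rate * ?D + d) * w s"
          using gap by (intro q_value_diff_le[OF s a v(1) vh(1) D vvh]) simp
        ultimately show "\<bar>A.q_value x s a - B.q_value vh s a\<bar> \<le> rate * C * w s + (rate * ?D + d) * w s"
          by linarith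
      qed
      then have "\<bar>x s - vh s\<bar> \<le> rate * C * w s + (rate * ?D + d) * w s"
        using s by (simp flip: x(2) greedy)
      moreover have "\<bar>v s - vh s\<bar> \<le> ?D * w s"
        using vvh s by (simp add: A.weight_bounded_def)
      ultimately have "\<bar>x s - v s\<bar> \<le> rate * C * w s + (rate * ?D + d + ?D) * w s"
        unfolding distrib_right[of _ ?D "w s"] by linarith
      then show "\<bar>x s - v s\<bar> \<le> (rate * C + 2 * ?D) * w s"
        unfolding two_D by (simp add: distrib_right)
    next
      show "0 \<le> w s" if "s \<in> states M" for s using A.weight_ge_1[OF that] by simp
    qed (use C0 s D rate_pos rate_less_1 in \<open>auto simp: A.weight_bounded_def\<close>)
  qed
qed

end

lemma (in mdp_pair) q_gap_if_mismatch:
  assumes u: "A.weighted_fun u" "\<And>s. s \<in> states M \<Longrightarrow> U s = ereal (u s)"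
    and d: "0 \<le> d" and mm: "mismatch_max w M Mh U \<le> ennreal d"
  shows "q_gap d u"
  unfolding q_gap_def
proof safe
  fix s a assume s: "s \<in> states M" and a: "a \<in> actions M"
  have "wnorm M w (\<lambda>s. bellman_pol M (open_loop M a) U s - bellman_pol Mh (open_loop Mh a) U s) \<le> ennreal d"
    using mm a by (auto simp: mismatch_max_def SUP_le_iff)
  then have "\<bar>bellman_pol M (open_loop M a) U s - bellman_pol Mh (open_loop Mh a) U s\<bar> \<le> ereal (d * w s)"
    using s by (simp add: A.wnorm_le_iff[OF d])
  moreover have "bellman_pol M (open_loop M a) U s = ereal (A.q_value u s a)"
    by (rule A.bellman_pol_open_loop[OF s a u])
  moreover have "bellman_pol Mh (open_loop Mh a) U s = ereal (B.q_value u s a)"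
    using s a u by (intro B.bellman_pol_open_loop) (simp_all add: same_states same_actions weighted_fun_eq)
  ultimately show "\<bar>A.q_value u s a - B.q_value u s a\<bar> \<le> d * w s" by simp
qed

lemma weighted_mdpI:
  assumes "is_mdp M" "\<forall>s\<in>states M. \<forall>a\<in>actions M. cmin \<le> cost M (s, a)" "\<forall>s\<in>states M. 1 \<le> w s"
    and "0 < \<kappa>" "discount M * \<kappa> < 1" and "\<forall>a\<in>actions M. open_loop M a \<in> stable_policies \<kappa> w M"
  shows "weighted_mdp M w \<kappa> cmin"
proof
  fix s a assume "s \<in> states M" "a \<in> actions M"
  with assms(6) pol_kernel_open_loop[OF assms(1) this]
  show "(\<integral>\<^sup>+s'. ennreal (w s') \<partial>trans_kernel M (s, a)) \<le> ennreal (\<kappa> * w s)"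
    by (fastforce simp: stable_policies_def)
qed (use assms in auto)

theorem theorem2:
  fixes M Mh :: "('s::polish_space, 'a::polish_space) mdp"
    and w :: "'s \<Rightarrow> real" and \<kappa> cmin :: real
    and V Vh :: "'s \<Rightarrow> ereal" and \<pi>h :: "'s \<Rightarrow> 'a measure"
  assumes mdps: "is_mdp M" "is_mdp Mh"
    and same: "states Mh = states M" "actions Mh = actions M" "discount Mh = discount M"
    and cmin: "\<forall>s\<in>states M. \<forall>a\<in>actions M. cmin \<le> cost M (s, a) \<and> cmin \<le> cost Mh (s, a)"
    and w: "\<forall>s\<in>states M. 1 \<le> w s"
    and kappa: "0 < \<kappa>" "discount M * \<kappa> < 1"
    and solvable: "dp_solvable cmin w M" "dp_solvable cmin w Mh"
    and opt: "optimal_value cmin w M V" "optimal_value cmin w Mh Vh"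
    and greedy_stable: "greedy M V \<inter> stable_policies \<kappa> w M \<noteq> {}"
      "greedy Mh Vh \<inter> stable_policies \<kappa> w M \<inter> stable_policies \<kappa> w Mh \<noteq> {}"
    and open_loop_stable:
      "\<forall>a\<in>actions M. open_loop M a \<in> stable_policies \<kappa> w M \<inter> stable_policies \<kappa> w Mh"
    and greedy_cross: "greedy M Vh \<noteq> {}" "greedy Mh V \<noteq> {}"
    and pi: "\<pi>h \<in> greedy Mh Vh \<inter> stable_policies \<kappa> w M \<inter> stable_policies \<kappa> w Mh"
  shows "wnorm M w (\<lambda>s. value_fun M \<pi>h s - V s)
           \<le> ennreal (2 / (1 - discount M * \<kappa>)) * mismatch_max w M Mh Vh \<and>
         wnorm M w (\<lambda>s. value_fun M \<pi>h s - V s)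
           \<le> ennreal (2 / (1 - discount M * \<kappa>)\<^sup>2) * mismatch_max w M Mh V"
proof -
  have "open_loop Mh a = open_loop M a" for a
    by (simp add: open_loop_def actionM_def same)
  then interpret mdp_pair M Mh w \<kappa> cmin
    using mdps same cmin w kappa open_loop_stable
    by (intro mdp_pair.intro mdp_pair_axioms.intro weighted_mdpI) auto
  obtain C1 where "stable_policy M w \<kappa> cmin \<pi>h C1"
    using A.stable_policy_if_mem[of \<pi>h] pi by blast
  then interpret PA: stable_policy M w \<kappa> cmin \<pi>h C1 .
  obtain C2 where "stable_policy Mh w \<kappa> cmin \<pi>h C2"
    using B.stable_policy_if_mem[of \<pi>h] pi by blast
  then interpret PB: stable_policy Mh w \<kappa> cmin \<pi>h C2 .
  obtain x where x: "A.weighted_fun x" "\<And>s. s \<in> states M \<Longrightarrow> value_fun M \<pi>h s = ereal (x s)"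
    "\<And>s. s \<in> states M \<Longrightarrow> x s = (\<integral>a. A.q_value x s a \<partial>\<pi>h s)"
    using PA.value_fun_real by blast
  obtain v where v: "A.weighted_fun v" "\<And>s. s \<in> states M \<Longrightarrow> V s = ereal (v s)"
    using A.wval_space_real[of V] opt by (auto simp: optimal_value_def)
  obtain vh where vhB: "B.weighted_fun vh" "\<And>s. s \<in> states Mh \<Longrightarrow> Vh s = ereal (vh s)"
    using B.wval_space_real[of Vh] opt by (auto simp: optimal_value_def)
  then have vh: "A.weighted_fun vh" "\<And>s. s \<in> states M \<Longrightarrow> Vh s = ereal (vh s)"
    by (simp_all add: weighted_fun_eq same)
  have v_opt: "ereal (v s) = (INF a\<in>actions M. ereal (A.q_value v s a))" if s: "s \<in> states M" for s
    using A.bellman_opt_q_value[OF s v] opt(1) s v(2)[OF s] by (simp add: optimal_value_def)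
  have vh_opt: "ereal (vh s) = (INF a\<in>actions M. ereal (B.q_value vh s a))"
    and vh_greedy: "vh s = (\<integral>a. B.q_value vh s a \<partial>\<pi>h s)" if s: "s \<in> states M" for s
  proof -
    have s': "s \<in> states Mh" using s by (simp add: same)
    have opt_s: "bellman_opt Mh Vh s = ereal (vh s)"
      using opt(2) s' vhB(2)[OF s'] by (simp add: optimal_value_def)
    then show "ereal (vh s) = (INF a\<in>actions M. ereal (B.q_value vh s a))"
      using B.bellman_opt_q_value[OF s' vhB] by (simp add: same)
    have "bellman_pol Mh \<pi>h Vh s = ereal (vh s)"
      using pi s' opt_s by (simp add: greedy_def)
    then show "vh s = (\<integral>a. B.q_value vh s a \<partial>\<pi>h s)"
      using PB.bellman_pol_q_value[OF s' vhB] by simp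
  qed
  have pair: "policy_pair M Mh w \<kappa> cmin \<pi>h C1 C2 x v vh d" if "0 \<le> d" for d
    using that x(1,3) v(1) v_opt vh(1) vh_opt vh_greedy by unfold_locales
  have norm: "wnorm M w (\<lambda>s. value_fun M \<pi>h s - V s) \<le> ennreal C"
    if "0 \<le> C" "A.weight_bounded C (\<lambda>s. x s - v s)" for C
    using that by (simp add: A.wnorm_le_iff A.weight_bounded_def x(2) v(2))
  show ?thesis
  proof
    show "wnorm M w (\<lambda>s. value_fun M \<pi>h s - V s)
        \<le> ennreal (2 / (1 - rate)) * mismatch_max w M Mh Vh"
    proof (rule ennreal_mult_le_if_real_bound)
      fix d :: real assume d: "0 \<le> d" and mm: "mismatch_max w M Mh Vh \<le> ennreal d"
      show "wnorm M w (\<lambda>s. value_fun M \<pi>h s - V s) \<le> ennreal (2 / (1 - rate) * d)"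
        using d rate_less_1
        by (intro norm policy_pair.regret_le_gap_at_model_optimum[OF pair[OF d]] q_gap_if_mismatch[OF vh d mm]) simp_all
    qed (use rate_less_1 in simp)
    show "wnorm M w (\<lambda>s. value_fun M \<pi>h s - V s)
        \<le> ennreal (2 / (1 - rate)\<^sup>2) * mismatch_max w M Mh V"
    proof (rule ennreal_mult_le_if_real_bound)
      fix d :: real assume d: "0 \<le> d" and mm: "mismatch_max w M Mh V \<le> ennreal d"
      show "wnorm M w (\<lambda>s. value_fun M \<pi>h s - V s) \<le> ennreal (2 / (1 - rate)\<^sup>2 * d)"
        using d rate_less_1
        by (intro norm policy_pair.regret_le_gap_at_true_optimum[OF pair[OF d]] q_gap_if_mismatch[OF v d mm]) simp_all
    qed (use rate_less_1 in simp)
  qed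
qed

end
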